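(* Fix $2\le d\le 7$. Then $\lim_{n\to\infty}\mu^w_{n,d}$ exists (in the local weak sense) for all good weight sequences $w$ and is independent of $w$. In particular, $\lim_{n\to\infty}\mu^{\{-k,\dots,k\}}_{n,d}$ exists for all integers $k\ge0$ and is independent of $k$.
   Context: A $d$-ary tree $\mathbb{T}_d$ is an infinite tree with root $\rho$ of degree $d$ and all other vertices of degree $d+1$; $\mathbb{T}^n_d$ is the subtree induced by vertices within distance $n$ of $\rho$, and its leaves are the vertices at distance exactly $n$. A $1$-Lipschitz function is an integer-valued $f$ with $|f(u)-f(v)|\le1$ for adjacent $u,v$. A sequence $w=(w(i))_{i\in\mathbb{Z}}\in[0,\infty)^{\mathbb{Z}}$ is good if $w(i)=w(-i)$ for all $i$, $w(0)>0$, and there exist an integer $k\ge0$ and $c\in[0,1)$ with $w(i)=w(i+1)$ for all $0\le i<k$ and $w(i+1)\le c\,w(i)$ for all $i\ge k$. $\mu^w_{n,d}$ is the probability measure on $1$-Lipschitz functions on $\mathbb{T}^n_d$ giving each such $f$ weight proportional to $\prod_{v\text{ leaf}}w(f(v))$. $\mu^{\{-k,\dots,k\}}_{n,d}$ is the uniform measure on $1$-Lipschitz functions on $\mathbb{T}^n_d$ whose leaf values lie in $\{-k,\dots,k\}$. Local weak convergence: for each $r\ge0$ the law of the restriction of $f$ to vertices within distance $r$ of $\rho$ converges to a probability measure. *)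

theory Defs
  imports "HOL-Analysis.Analysis" "HOL-Probability.Probability_Mass_Function"
begin

text \<open>Vertices of the d-ary tree truncated at depth n: words over {0..<d} of length at most n.
  The root is the empty word; the children of v are v @ [i], i < d.  So the root has degree d
  and every other vertex has degree d+1.\<close>
definition tree_verts :: "nat \<Rightarrow> nat \<Rightarrow> nat list set" where
  "tree_verts n d = {v. length v \<le> n \<and> set v \<subseteq> {..<d}}"

definition tree_leaves :: "nat \<Rightarrow> nat \<Rightarrow> nat list set" where
  "tree_leaves n d = {v \<in> tree_verts n d. length v = n}"

definition lip_funs :: "nat \<Rightarrow> nat \<Rightarrow> (nat list \<Rightarrow> int) set" where
  "lip_funs n d = {f. (\<forall>v i. v @ [i] \<in> tree_verts n d \<longrightarrow> \<bar>f v - f (v @ [i])\<bar> \<le> 1)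
                     \<and> (\<forall>v. v \<notin> tree_verts n d \<longrightarrow> f v = 0)}"

definition good_weight :: "(int \<Rightarrow> real) \<Rightarrow> bool" where
  "good_weight w \<longleftrightarrow> (\<forall>i. w i \<ge> 0) \<and> (\<forall>i. w i = w (-i)) \<and> w 0 > 0 \<and>
     (\<exists>(k::nat) (c::real). 0 \<le> c \<and> c < 1 \<and>
        (\<forall>i::nat. i < k \<longrightarrow> w (int i) = w (int i + 1)) \<and>
        (\<forall>i::nat. i \<ge> k \<longrightarrow> w (int i + 1) \<le> c * w (int i)))"

definition leaf_weight :: "nat \<Rightarrow> nat \<Rightarrow> (int \<Rightarrow> real) \<Rightarrow> (nat list \<Rightarrow> int) \<Rightarrow> real" where
  "leaf_weight n d w f = (\<Prod>v\<in>tree_leaves n d. w (f v))"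

definition restr :: "nat \<Rightarrow> (nat list \<Rightarrow> int) \<Rightarrow> (nat list \<Rightarrow> int)" where
  "restr r f = (\<lambda>v. if length v \<le> r then f v else 0)"

definition lawW :: "nat \<Rightarrow> nat \<Rightarrow> (int \<Rightarrow> real) \<Rightarrow> nat \<Rightarrow> (nat list \<Rightarrow> int) \<Rightarrow> real" where
  "lawW n d w r \<phi> =
     infsum (leaf_weight n d w) {f \<in> lip_funs n d. restr r f = \<phi>}
     / infsum (leaf_weight n d w) (lip_funs n d)"

definition lip_funs_bdd :: "nat \<Rightarrow> nat \<Rightarrow> nat \<Rightarrow> (nat list \<Rightarrow> int) set" where
  "lip_funs_bdd n d k = {f \<in> lip_funs n d. \<forall>v\<in>tree_leaves n d. - int k \<le> f v \<and> f v \<le> int k}"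

definition lawU :: "nat \<Rightarrow> nat \<Rightarrow> nat \<Rightarrow> nat \<Rightarrow> (nat list \<Rightarrow> int) \<Rightarrow> real" where
  "lawU n d k r \<phi> =
     real (card {f \<in> lip_funs_bdd n d k. restr r f = \<phi>}) / real (card (lip_funs_bdd n d k))"

end

theory Submission
  imports Defs
begin

text \<open>If \<open>W\<^sub>n(i)\<close> is the total weight of the functions on the tree of depth \<open>n\<close> with root value \<open>i\<close>, then
  \<open>W\<^sub>n\<^sub>+\<^sub>1(i) = (W\<^sub>n(i-1) + W\<^sub>n(i) + W\<^sub>n(i+1))\<^sup>d\<close>, and the law near the root is determined by the ratios
  \<open>a\<^sub>i = W\<^sub>n(i+1)/W\<^sub>n(i)\<close>, \<open>i \<ge> 0\<close>. The induced map on ratios is increasing in every coordinate, except that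
  the new \<open>a\<^sub>0\<close> is decreasing in the old \<open>a\<^sub>0\<close>. Iterating it on pairs (upper bound, lower bound) gives monotone
  envelopes that squeeze every ratio sequence. Their limits \<open>p \<ge> m\<close> satisfy coupled fixed point equations,
  and for \<open>d \<le> 7\<close> these force \<open>p = m\<close>: the tail differences \<open>p\<^sub>i - m\<^sub>i\<close> are at most \<open>\<kappa>(p\<^sub>0 - m\<^sub>0)\<close>, and
  \<open>ln (p\<^sub>0/m\<^sub>0)\<close> is contracted. So the ratios converge to a limit that does not depend on the leaf weight,
  and dominated convergence, with a geometric majorant, carries this over to the laws.\<close>

section \<open>The recursion for ratios\<close>

text \<open>In coordinates other than the root, multiplying out \<open>1/a\<^sub>i\<^sub>-\<^sub>1\<close> makes the recursion valid also where the
  weights vanish and the ratios take the junk value \<open>0/0 = 0\<close>.\<close>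

definition ratio_step :: "nat \<Rightarrow> (nat \<Rightarrow> real) \<Rightarrow> (nat \<Rightarrow> real) \<Rightarrow> nat \<Rightarrow> real" where
  "ratio_step d p m i = (case i of
       0 \<Rightarrow> ((1 + m 0 + m 0 * p 1) / (1 + 2 * m 0)) ^ d
     | Suc j \<Rightarrow> (p j * (1 + p (Suc j) + p (Suc j) * p (Suc (Suc j))) / (1 + p j + p j * p (Suc j))) ^ d)"

lemma ratio_step_simps [simp]:
  "ratio_step d p m 0 = ((1 + m 0 + m 0 * p 1) / (1 + 2 * m 0)) ^ d"
  "ratio_step d p m (Suc j) =
     (p j * (1 + p (Suc j) + p (Suc j) * p (Suc (Suc j))) / (1 + p j + p j * p (Suc j))) ^ d"
  by (simp_all add: ratio_step_def)

text \<open>The quotient is a Moebius function of the root ratio, and cross-multiplying two of its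
  values leaves \<open>(a' - a) * (1 - b)\<close>. So it decreases in \<open>a\<close> exactly
  because the neighbouring ratio is at most 1.\<close>

lemma root_ratio_mono:
  fixes a b a' b' :: real
  assumes "0 \<le> a" "a \<le> a'" "0 \<le> b'" "b' \<le> b" "b \<le> 1"
  shows "(1 + a' + a' * b') / (1 + 2 * a') \<le> (1 + a + a * b) / (1 + 2 * a)"
proof -
  have "(1 + a' + a' * b') / (1 + 2 * a') \<le> (1 + a' + a' * b) / (1 + 2 * a')"
    using assms by (intro divide_right_mono) (auto intro: mult_left_mono)
  also have "\<dots> \<le> (1 + a + a * b) / (1 + 2 * a)"
  proof -
    have "(a' - a) * (1 - b) \<ge> 0" using assms by simp
    then have "(1 + a' + a' * b) * (1 + 2 * a) \<le> (1 + a + a * b) * (1 + 2 * a')"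
      by (simp add: algebra_simps)
    then show ?thesis using assms by (simp add: frac_le_eq divide_le_eq) (simp add: field_simps)
  qed
  finally show ?thesis .
qed

text \<open>Telescoping: \<open>c\<close>, \<open>a\<close>, \<open>b\<close> are changed one at a
  time, and each coefficient is an exact difference quotient. All three are nonnegative, so the
  identity yields both monotonicity and Lipschitz bounds.\<close>

lemma inner_diff:
  fixes a b c a' b' c' :: real
  assumes "0 \<le> a'" "a' \<le> a" "0 \<le> b'" "b' \<le> b" "0 \<le> c'" "c' \<le> c"
  shows "c * (1 + a + a * b) / (1 + c + c * a) - c' * (1 + a' + a' * b') / (1 + c' + c' * a')
    = (1 + a + a * b) / ((1 + c + c * a) * (1 + c' + c' * a)) * (c - c')
    + c' * (1 + b + b * c') / ((1 + c' + c' * a) * (1 + c' + c' * a')) * (a - a')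
    + c' * a' / (1 + c' + c' * a') * (b - b')"
proof -
  have pos: "1 + c + c * a > 0" "1 + c' + c' * a > 0" "1 + c' + c' * a' > 0"
    using assms by (auto intro!: add_pos_nonneg)
  have 1: "c * (1 + a + a * b) / (1 + c + c * a) - c' * (1 + a + a * b) / (1 + c' + c' * a)
    = (1 + a + a * b) / ((1 + c + c * a) * (1 + c' + c' * a)) * (c - c')"
    using pos by (simp add: divide_simps) (simp add: algebra_simps)
  have 2: "c' * (1 + a + a * b) / (1 + c' + c' * a) - c' * (1 + a' + a' * b) / (1 + c' + c' * a')
    = c' * (1 + b + b * c') / ((1 + c' + c' * a) * (1 + c' + c' * a')) * (a - a')"
    using pos by (simp add: divide_simps) (simp add: algebra_simps)
  have 3: "c' * (1 + a' + a' * b) / (1 + c' + c' * a') - c' * (1 + a' + a' * b') / (1 + c' + c' * a')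
    = c' * a' / (1 + c' + c' * a') * (b - b')"
    using pos by (simp add: divide_simps) (simp add: algebra_simps)
  from 1 2 3 show ?thesis by linarith
qed

lemma inner_ratio_mono:
  fixes a b c a' b' c' :: real
  assumes "0 \<le> a'" "a' \<le> a" "0 \<le> b'" "b' \<le> b" "0 \<le> c'" "c' \<le> c"
  shows "c' * (1 + a' + a' * b') / (1 + c' + c' * a') \<le> c * (1 + a + a * b) / (1 + c + c * a)"
proof -
  have "0 \<le> (1 + a + a * b) / ((1 + c + c * a) * (1 + c' + c' * a)) * (c - c')
    + c' * (1 + b + b * c') / ((1 + c' + c' * a) * (1 + c' + c' * a')) * (a - a')
    + c' * a' / (1 + c' + c' * a') * (b - b')"
    using assms by (auto intro!: add_nonneg_nonneg mult_nonneg_nonneg divide_nonneg_nonneg)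
  then show ?thesis using inner_diff[OF assms] by simp
qed

lemma inner_ratio_nonneg:
  fixes a b c :: real
  assumes "0 \<le> a" "0 \<le> b" "0 \<le> c"
  shows "0 \<le> c * (1 + a + a * b) / (1 + c + c * a)"
  using assms by (auto intro!: divide_nonneg_nonneg add_nonneg_nonneg)

text \<open>Equal neighbouring ratios are reproduced before the power is taken, so a constant
  stretch \<open>c\<close> becomes \<open>c ^ d\<close>.\<close>

lemma inner_ratio_diag:
  fixes c :: real
  assumes "0 \<le> c"
  shows "c * (1 + c + c * c) / (1 + c + c * c) = c"
proof -
  have "1 + c + c * c > 0" using assms by (auto intro!: add_pos_nonneg)
  then show ?thesis by simp
qed

text \<open>The second argument enters only through \<open>m 0\<close>, the one decreasing
  dependence. Splitting it off makes the step monotone: raising \<open>p\<close> and lowering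
  \<open>m 0\<close> raises every coordinate.\<close>

lemma ratio_step_mono:
  assumes "\<And>i. 0 \<le> p i" "\<And>i. p i \<le> p' i" "\<And>i. p' i \<le> 1" "0 \<le> m' 0" "m' 0 \<le> m 0"
  shows "ratio_step d p m i \<le> ratio_step d p' m' i"
proof (cases i)
  case 0
  have "(1 + m 0 + m 0 * p 1) / (1 + 2 * m 0) \<le> (1 + m' 0 + m' 0 * p' 1) / (1 + 2 * m' 0)"
    using assms by (intro root_ratio_mono)
  then show ?thesis unfolding 0 ratio_step_simps
    using assms(1)[of 1] assms(4,5) by (intro power_mono) (auto intro!: divide_nonneg_nonneg add_nonneg_nonneg)
next
  case (Suc j)
  show ?thesis unfolding Suc ratio_step_simps
    using assms(1,2) by (intro power_mono inner_ratio_mono inner_ratio_nonneg)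
qed

lemma ratio_step_nonneg:
  assumes "\<And>i. 0 \<le> p i" "0 \<le> m 0"
  shows "0 \<le> ratio_step d p m i"
  using assms by (cases i)
    (auto intro!: zero_le_power divide_nonneg_nonneg add_nonneg_nonneg)

section \<open>Lipschitz bounds for the inner coordinates\<close>

lemma power_diff_le:
  fixes x y h :: real
  assumes "0 \<le> y" "y \<le> x" "x \<le> h"
  shows "x ^ d - y ^ d \<le> real d * h ^ (d - 1) * (x - y)"
proof -
  have "x ^ d - y ^ d = (x - y) * (\<Sum>i<d. y ^ (d - Suc i) * x ^ i)"
    by (rule power_diff_sumr2)
  also have "\<dots> \<le> (x - y) * (\<Sum>i<d. h ^ (d - 1))"
  proof (intro mult_left_mono sum_mono)
    fix i assume "i \<in> {..<d}"
    then have e: "d - 1 = (d - Suc i) + i" by auto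
    show "y ^ (d - Suc i) * x ^ i \<le> h ^ (d - 1)"
      unfolding e power_add using assms by (intro mult_mono power_mono) auto
  qed (use assms in auto)
  finally show ?thesis by (simp add: mult_ac)
qed

text \<open>The coefficients of \<open>inner_diff\<close> are bounded uniformly over the range of
  the ratios. The lower bound \<open>e\<close> on the left neighbour gains the factor
  \<open>(1 + e)\<^sup>2\<close>, which is exploited where that neighbour is the root ratio.\<close>

lemma inner_power_diff_le:
  fixes a b c a' b' c' :: real
  assumes "0 \<le> a'" "a' \<le> a" "a \<le> C" "0 \<le> b'" "b' \<le> b" "b \<le> C" "0 \<le> e" "e \<le> c'" "c' \<le> c" "c \<le> 1"
    and h: "c * (1 + a + a * b) / (1 + c + c * a) \<le> h"
  shows "(c * (1 + a + a * b) / (1 + c + c * a)) ^ d - (c' * (1 + a' + a' * b') / (1 + c' + c' * a')) ^ d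
    \<le> real d * h ^ (d - 1) * ((1 + C + C\<^sup>2) / (1 + e)\<^sup>2 * (c - c') + (1 + 2 * C) / 4 * (a - a') + C / 2 * (b - b'))"
    (is "?g ^ d - ?g' ^ d \<le> _ * ?B")
proof -
  have c0: "0 \<le> c'" "0 \<le> c" "0 \<le> C" "0 \<le> a" "0 \<le> b" using assms by auto
  have mono: "?g' \<le> ?g" using assms c0 by (intro inner_ratio_mono) auto
  have nn: "0 \<le> ?g'" using assms c0 by (intro inner_ratio_nonneg) auto
  have pos: "1 + c' > 0" "1 + c > 0" "1 + c' + c' * a > 0" "1 + c' + c' * a' > 0" "1 + c + c * a > 0"
    using assms c0 by (auto intro!: add_pos_nonneg)
  have "?g - ?g' = (1 + a + a * b) / ((1 + c + c * a) * (1 + c' + c' * a)) * (c - c')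
    + c' * (1 + b + b * c') / ((1 + c' + c' * a) * (1 + c' + c' * a')) * (a - a')
    + c' * a' / (1 + c' + c' * a') * (b - b')"
    using assms c0 by (intro inner_diff) auto
  also have "\<dots> \<le> ?B"
  proof (intro add_mono mult_right_mono)
    have "(1 + a + a * b) / ((1 + c + c * a) * (1 + c' + c' * a)) \<le> (1 + C + C\<^sup>2) / ((1 + e) * (1 + e))"
    proof (rule frac_le)
      have "0 \<le> c * a" "0 \<le> c' * a" using c0 by auto
      then show "(1 + e) * (1 + e) \<le> (1 + c + c * a) * (1 + c' + c' * a)"
        using assms pos by (intro mult_mono) linarith+
      show "1 + a + a * b \<le> 1 + C + C\<^sup>2"
        using assms c0 unfolding power2_eq_square by (intro add_mono mult_mono) auto
    qed (use assms c0 in auto)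
    then show "(1 + a + a * b) / ((1 + c + c * a) * (1 + c' + c' * a)) \<le> (1 + C + C\<^sup>2) / (1 + e)\<^sup>2"
      by (simp add: power2_eq_square)
    have "c' * (1 + b + b * c') / ((1 + c' + c' * a) * (1 + c' + c' * a'))
        \<le> c' * (1 + b + b * c') / ((1 + c') * (1 + c'))"
      using assms c0 pos by (intro divide_left_mono mult_mono) (auto intro!: mult_nonneg_nonneg mult_pos_pos add_nonneg_nonneg)
    \<comment> \<open>The right-hand side is the value at \<open>c' = 1\<close>.\<close>
    also have "\<dots> \<le> (1 + 2 * b) / 4"
    proof -
      have "(1 + 2 * b) * ((1 + c') * (1 + c')) - 4 * (c' * (1 + b + b * c'))
          = (1 - c')\<^sup>2 + 2 * b * (1 - c'\<^sup>2)"
        by (simp add: power2_eq_square algebra_simps)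
      also have "\<dots> \<ge> 0"
        using assms c0 by (auto intro!: add_nonneg_nonneg mult_nonneg_nonneg simp: abs_square_le_1)
      finally show ?thesis using pos by (simp add: divide_le_eq)
    qed
    also have "\<dots> \<le> (1 + 2 * C) / 4" using assms by simp
    finally show "c' * (1 + b + b * c') / ((1 + c' + c' * a) * (1 + c' + c' * a')) \<le> (1 + 2 * C) / 4" .
    have "c' * a' / (1 + c' + c' * a') \<le> a' / 2"
    proof -
      have "0 \<le> a' * (1 - c') + c' * a' * a'" using assms c0 by simp
      then show ?thesis using pos by (simp add: divide_le_eq algebra_simps)
    qed
    also have "\<dots> \<le> C / 2" using assms by simp
    finally show "c' * a' / (1 + c' + c' * a') \<le> C / 2" .
  qed (use assms in auto)
  finally have "?g - ?g' \<le> ?B" .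
  have "h \<ge> 0" using mono nn h by linarith
  have "?g ^ d - ?g' ^ d \<le> real d * h ^ (d - 1) * (?g - ?g')"
    using power_diff_le[OF nn mono h] .
  also have "\<dots> \<le> real d * h ^ (d - 1) * ?B"
    using \<open>?g - ?g' \<le> ?B\<close> \<open>h \<ge> 0\<close> by (intro mult_left_mono) auto
  finally show ?thesis .
qed

text \<open>Convexity of artanh on [0, 1) together with artanh 0 = 0, in the form of a comparison of
  derivatives.\<close>

lemma artanh_scale:
  fixes l x :: real
  assumes "0 \<le> l" "l \<le> 1" "0 \<le> x" "x < 1"
  shows "artanh (l * x) \<le> l * artanh x"
proof -
  have "(\<lambda>x. l * artanh x - artanh (l * x)) 0 \<le> (\<lambda>x. l * artanh x - artanh (l * x)) x"
  proof (rule DERIV_nonneg_imp_nondecreasing[OF assms(3)])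
    fix y assume y: "0 \<le> y" "y \<le> x"
    have ly: "0 \<le> l * y" "l * y \<le> y" using assms y by (auto intro: mult_left_le_one_le)
    have "((\<lambda>x. artanh (l * x)) has_real_derivative (1 / (1 - (l * y)\<^sup>2)) * l) (at y)"
      using y ly assms
      by (intro DERIV_chain2[OF artanh_real_has_field_derivative]) (auto intro!: derivative_eq_intros)
    then have "((\<lambda>x. l * artanh x - artanh (l * x)) has_real_derivative
        (l * (1 / (1 - y\<^sup>2)) - (1 / (1 - (l * y)\<^sup>2)) * l)) (at y)"
      using y ly assms by (auto intro!: derivative_eq_intros)
    moreover have "0 \<le> l * (1 / (1 - y\<^sup>2)) - (1 / (1 - (l * y)\<^sup>2)) * l"
    proof -
      have "(l * y)\<^sup>2 \<le> y\<^sup>2" using ly by (intro power_mono)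
      moreover have "y\<^sup>2 < 1" using y assms by (simp add: power_less_one_iff abs_square_less_1)
      ultimately have "1 / (1 - (l * y)\<^sup>2) \<le> 1 / (1 - y\<^sup>2)"
        by (intro divide_left_mono) (auto intro!: mult_pos_pos)
      then show ?thesis using mult_left_mono[OF _ assms(1)] by (simp add: mult.commute) fastforce
    qed
    ultimately show "\<exists>z. ((\<lambda>x. l * artanh x - artanh (l * x)) has_real_derivative z) (at y) \<and> 0 \<le> z"
      by blast
  qed
  then show ?thesis by simp
qed

text \<open>The derivative \<open>1 / (1 - y\<^sup>2)\<close> is at least 1. This lets a term linear
  in the root difference be absorbed into an artanh.\<close>

lemma artanh_ge_self:
  fixes x :: real
  assumes "0 \<le> x" "x < 1"
  shows "x \<le> artanh x"
proof -
  have "(\<lambda>x. artanh x - x) 0 \<le> (\<lambda>x. artanh x - x) x"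
  proof (rule DERIV_nonneg_imp_nondecreasing[OF assms(1)])
    fix y assume y: "0 \<le> y" "y \<le> x"
    have "y\<^sup>2 < 1" using y assms by (simp add: abs_square_less_1)
    then have "0 \<le> 1 / (1 - y\<^sup>2) - 1" by (simp add: field_simps)
    moreover have "((\<lambda>x. artanh x - x) has_real_derivative (1 / (1 - y\<^sup>2) - 1)) (at y)"
      using y assms by (auto intro!: derivative_eq_intros)
    ultimately show "\<exists>z. ((\<lambda>x. artanh x - x) has_real_derivative z) (at y) \<and> 0 \<le> z"
      by blast
  qed
  then show ?thesis by simp
qed

section \<open>Uniqueness of the coupled fixed point\<close>

text \<open>This is the inner ratio in the worst case: left neighbour 1, all later ratios
  \<open>c\<close>. The base is at most 1, so d = 2 is the extreme exponent; there the gap factors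
  as \<open>(1 - c) * (c ^ 3 + 2 * c\<^sup>2 + c - 1)\<close>, positive from 1/2 on. The factors
  \<open>1 *\<close> keep the shape of \<open>inner_ratio_mono\<close>.\<close>

lemma inner_ratio_contract:
  fixes c :: real
  assumes "2 \<le> d" "1 / 2 \<le> c" "c < 1"
  shows "(1 * (1 + c + c * c) / (1 + 1 + 1 * c)) ^ d < c"
proof -
  have r: "0 \<le> (1 + c + c * c) / (2 + c)" "(1 + c + c * c) / (2 + c) \<le> 1"
    using assms by (auto simp: divide_le_eq mult_le_one)
  have "(1 / 2) ^ 3 \<le> c ^ 3" "(1 / 2)\<^sup>2 \<le> c\<^sup>2"
    using assms by (auto intro!: power_mono)
  then have "c ^ 3 + 2 * c\<^sup>2 + c - 1 > 0"
    using assms by (simp add: power3_eq_cube power2_eq_square)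
  then have "0 < (1 - c) * (c ^ 3 + 2 * c\<^sup>2 + c - 1)" using assms by simp
  also have "\<dots> = c * (2 + c)\<^sup>2 - (1 + c + c * c)\<^sup>2"
    by (simp add: power3_eq_cube power2_eq_square algebra_simps)
  finally have "((1 + c + c * c) / (2 + c))\<^sup>2 < c"
    using assms by (simp add: power_divide divide_less_eq)
  moreover have "((1 + c + c * c) / (2 + c)) ^ d \<le> ((1 + c + c * c) / (2 + c))\<^sup>2"
    using r assms by (intro power_decreasing)
  ultimately show ?thesis by simp
qed

lemma affine_pos_between:
  fixes a b t x u :: real
  assumes f: "\<And>t. f t = a + b * t" and "0 < f x" "0 < f u" "x \<le> t" "t \<le> u"
  shows "0 < f t"
proof (cases "b \<ge> 0")
  case True
  then have "b * x \<le> b * t" using assms by (intro mult_left_mono)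
  then show ?thesis using assms(2,3) unfolding f by linarith
next
  case False
  then have "b * u \<le> b * t" using assms by (intro mult_left_mono_neg) auto
  then show ?thesis using assms(2,3) unfolding f by linarith
qed

text \<open>These are the properties of the limits of an upper and a lower envelope. The constant
  sequence 1, which belongs to flat weights, also solves the fixed point equations; the tail bound c
  < 1 excludes it.\<close>

locale fixed_pair =
  fixes d :: nat and p m :: "nat \<Rightarrow> real" and c :: real
  assumes d: "2 \<le> d"
    and m_nonneg: "0 \<le> m i" and m_le_p: "m i \<le> p i" and p_le_1: "p i \<le> 1"
    and p_Suc_le: "p (Suc i) \<le> c" and c_less_1: "c < 1"
    and p_fix: "p i = ratio_step d p m i" and m_fix: "m i = ratio_step d m p i"
begin

lemma p_nonneg: "0 \<le> p i"
  using m_nonneg m_le_p by (rule order_trans)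

lemmas p_0 = p_fix[of 0, unfolded ratio_step_simps]
  and m_0 = m_fix[of 0, unfolded ratio_step_simps]
  and p_Suc = p_fix[of "Suc j" for j, unfolded ratio_step_simps]
  and m_Suc = m_fix[of "Suc j" for j, unfolded ratio_step_simps]

text \<open>The supremum s of the tail obeys the worst-case inequality s \<le> ((1 + s + s s) / (2 +
  s))^d, which \<open>inner_ratio_contract\<close> rules out for 1/2 \<le> s < 1.\<close>

lemma p_Suc_le_half: "p (Suc i) \<le> 1 / 2"
proof (rule ccontr)
  assume "\<not> p (Suc i) \<le> 1 / 2"
  define s where "s = (SUP i. p (Suc i))"
  have bdd: "bdd_above (range (\<lambda>i. p (Suc i)))"
    using p_le_1 by (intro bdd_aboveI[of _ 1]) auto
  have le: "p (Suc j) \<le> s" for j unfolding s_def by (rule cSUP_upper[OF _ bdd]) simp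
  have s: "1 / 2 \<le> s" using le[of i] \<open>\<not> p (Suc i) \<le> 1 / 2\<close> by linarith
  have "s \<le> c" unfolding s_def by (rule cSUP_least) (auto intro: p_Suc_le)
  then have s1: "s < 1" using c_less_1 by simp
  have "p (Suc j) \<le> (1 * (1 + s + s * s) / (1 + 1 + 1 * s)) ^ d" for j
    by (subst p_Suc) (use le p_nonneg p_le_1 in \<open>intro power_mono inner_ratio_mono inner_ratio_nonneg; auto\<close>)
  then have "s \<le> (1 * (1 + s + s * s) / (1 + 1 + 1 * s)) ^ d"
    unfolding s_def[symmetric] by (subst s_def) (rule cSUP_least; simp)
  with inner_ratio_contract[OF d s s1] show False by linarith
qed

section \<open>Numerical enclosures of a fixed pair\<close>

lemma p_0_le:
  assumes "0 \<le> x" "x \<le> m 0" "p 1 \<le> C" "C \<le> 1" "(1 + x + x * C) ^ d \<le> y * (1 + 2 * x) ^ d"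
  shows "p 0 \<le> y"
proof -
  have "p 0 \<le> ((1 + x + x * C) / (1 + 2 * x)) ^ d"
    using assms p_nonneg[of 1] m_nonneg[of 0]
    by (subst p_0, intro power_mono root_ratio_mono) (auto intro!: divide_nonneg_nonneg add_nonneg_nonneg)
  also have "\<dots> \<le> y" using assms by (simp add: power_divide divide_le_eq)
  finally show ?thesis .
qed

lemma m_0_ge:
  assumes "p 0 \<le> y" "x * (1 + 2 * y) ^ d \<le> (1 + y) ^ d"
  shows "x \<le> m 0"
proof -
  have y: "0 \<le> y" using assms p_nonneg[of 0] by linarith
  then have "x \<le> ((1 + y) / (1 + 2 * y)) ^ d" using assms by (simp add: power_divide le_divide_eq)
  also have "\<dots> = ((1 + y + y * 0) / (1 + 2 * y)) ^ d" by simp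
  also have "\<dots> \<le> m 0"
    using assms y p_nonneg[of 0] m_nonneg[of 1] m_le_p[of 1] p_le_1[of 1]
    by (subst m_0, intro power_mono root_ratio_mono) (auto intro!: divide_nonneg_nonneg add_nonneg_nonneg)
  finally show ?thesis .
qed

text \<open>The tail is bounded only from above, its lower bound being 0. The condition C \<le> y
  makes y a bound for all \<open>p i\<close>, so that y can stand for any left neighbour.\<close>

definition box :: "real \<Rightarrow> real \<Rightarrow> real \<Rightarrow> bool" where
  "box x y C \<longleftrightarrow> 0 \<le> x \<and> x \<le> m 0 \<and> p 0 \<le> y \<and> y \<le> 1 \<and> (\<forall>i. p (Suc i) \<le> C) \<and> C \<le> y"

lemma box_start: "box 0 1 (1 / 2)"
  unfolding box_def using m_nonneg p_le_1 p_Suc_le_half by auto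

text \<open>The three bounds are improved in turn: C' from the inner ratio at (y, C, C), then x'
  from y with the tail dropped, then y' from the new x' and C'. Denominators are cleared so that
  instances with numerals are decided by evaluation.\<close>

lemma box_step:
  assumes "box x y C"
    and C': "(y * (1 + C + C * C)) ^ d \<le> C' * (1 + y + y * C) ^ d"
    and x': "0 \<le> x'" "x' * (1 + 2 * y) ^ d \<le> (1 + y) ^ d"
    and y': "(1 + x' + x' * C') ^ d \<le> y' * (1 + 2 * x') ^ d"
    and "C' \<le> y'" "y' \<le> 1"
  shows "box x' y' C'"
proof -
  have b: "0 \<le> x" "x \<le> m 0" "p 0 \<le> y" "y \<le> 1" "\<And>i. p (Suc i) \<le> C" "C \<le> y"
    using assms(1) by (auto simp: box_def)
  have nn: "0 \<le> y" "0 \<le> C" using b(3,5) p_nonneg order_trans by blast+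
  have pC: "p (Suc i) \<le> C'" for i
  proof -
    have "p i \<le> y" using b by (cases i) (auto intro: order_trans)
    then have "p (Suc i) \<le> (y * (1 + C + C * C) / (1 + y + y * C)) ^ d"
      using b p_nonneg by (subst p_Suc, intro power_mono inner_ratio_mono inner_ratio_nonneg) auto
    also have "\<dots> \<le> C'"
    proof -
      have "0 < 1 + y + y * C" using nn by (auto intro!: add_pos_nonneg)
      then show ?thesis using C' by (simp add: power_divide divide_le_eq)
    qed
    finally show ?thesis .
  qed
  moreover have "x' \<le> m 0" using m_0_ge[OF b(3) x'(2)] .
  moreover have "p 0 \<le> y'"
    using p_0_le[OF x'(1) \<open>x' \<le> m 0\<close> _ _ y'] pC[of 0] assms by simp
  ultimately show ?thesis using assms by (simp add: box_def)
qed

text \<open>Let s be the supremum of the tail differences and E the root difference. The first tail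
  coordinate gives a bound affine in E and s, whose solution is at most \<kappa> E. All later
  coordinates give \<theta> s with \<theta> < 1. Whichever bound dominates, s \<le> \<kappa>
  E.\<close>

lemma tail_diff_le:
  assumes "box x y C"
    and h: "y * (1 + C + C * C) \<le> h * (1 + y + y * C)"
    and t: "real d * C ^ (d - 1) * ((1 + C + C\<^sup>2) + ((1 + 2 * C) / 4 + C / 2)) < 1"
    and b: "real d * h ^ (d - 1) * ((1 + 2 * C) / 4 + C / 2) < 1"
    and \<kappa>: "real d * h ^ (d - 1) * ((1 + C + C\<^sup>2) / (1 + x)\<^sup>2 + \<kappa> * ((1 + 2 * C) / 4 + C / 2)) \<le> \<kappa>"
      "0 \<le> \<kappa>"
  shows "p (Suc i) - m (Suc i) \<le> \<kappa> * (p 0 - m 0)"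
proof -
  have bx: "0 \<le> x" "x \<le> m 0" "p 0 \<le> y" "y \<le> 1" "\<And>i. p (Suc i) \<le> C" "C \<le> y"
    using assms(1) by (auto simp: box_def)
  have nn: "0 \<le> y" "0 \<le> C" using bx(3,5) p_nonneg order_trans by blast+
  have yC: "0 < 1 + y + y * C" using nn by (auto intro!: add_pos_nonneg)
  have "0 \<le> y * (1 + C + C * C)" using nn by (auto intro!: mult_nonneg_nonneg add_nonneg_nonneg)
  with h have "0 \<le> h * (1 + y + y * C)" by linarith
  then have h0: "0 \<le> h" using yC by (simp add: zero_le_mult_iff)
  define s where "s = (SUP i. p (Suc i) - m (Suc i))"
  define B where "B = (1 + 2 * C) / 4 + C / 2"
  define E where "E = p 0 - m 0"
  have E0: "0 \<le> E" using m_le_p by (simp add: E_def)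
  have B0: "0 \<le> B" using nn by (simp add: B_def)
  have bdd: "bdd_above (range (\<lambda>i. p (Suc i) - m (Suc i)))"
  proof (intro bdd_aboveI[of _ 1], clarify)
    fix i show "p (Suc i) - m (Suc i) \<le> 1" using p_le_1[of "Suc i"] m_nonneg[of "Suc i"] by linarith
  qed
  have le: "p (Suc j) - m (Suc j) \<le> s" for j unfolding s_def by (rule cSUP_upper[OF _ bdd]) simp
  have s0: "0 \<le> s" using le[of 0] m_le_p[of "Suc 0"] by linarith
  have step: "p (Suc j) - m (Suc j) \<le> real d * g ^ (d - 1) * ((1 + C + C\<^sup>2) / (1 + e)\<^sup>2 * (p j - m j) + B * s)"
    if "0 \<le> e" "e \<le> m j" "0 \<le> g" "p j * (1 + p (Suc j) + p (Suc j) * p (Suc (Suc j))) / (1 + p j + p j * p (Suc j)) \<le> g"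
    for j e g
  proof -
    have "p (Suc j) - m (Suc j)
      = (p j * (1 + p (Suc j) + p (Suc j) * p (Suc (Suc j))) / (1 + p j + p j * p (Suc j))) ^ d
      - (m j * (1 + m (Suc j) + m (Suc j) * m (Suc (Suc j))) / (1 + m j + m j * m (Suc j))) ^ d"
      by (rule arg_cong2[OF p_Suc m_Suc])
    also have "\<dots> \<le> real d * g ^ (d - 1) * ((1 + C + C\<^sup>2) / (1 + e)\<^sup>2 * (p j - m j)
        + (1 + 2 * C) / 4 * (p (Suc j) - m (Suc j)) + C / 2 * (p (Suc (Suc j)) - m (Suc (Suc j))))"
      using that bx m_nonneg m_le_p p_le_1 by (intro inner_power_diff_le) auto
    also have "\<dots> \<le> real d * g ^ (d - 1) * ((1 + C + C\<^sup>2) / (1 + e)\<^sup>2 * (p j - m j)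
        + (1 + 2 * C) / 4 * s + C / 2 * s)"
      using that nn le by (intro mult_left_mono add_mono) auto
    finally show ?thesis by (simp add: B_def algebra_simps)
  qed
  \<comment> \<open>Here the left neighbour is the root, so the lower bound x on \<open>m 0\<close>
    is available.\<close>
  have first: "p (Suc 0) - m (Suc 0) \<le> real d * h ^ (d - 1) * ((1 + C + C\<^sup>2) / (1 + x)\<^sup>2 * E + B * s)"
    unfolding E_def
  proof (rule step)
    have "p 0 * (1 + p (Suc 0) + p (Suc 0) * p (Suc (Suc 0))) / (1 + p 0 + p 0 * p (Suc 0))
        \<le> y * (1 + C + C * C) / (1 + y + y * C)"
      using bx p_nonneg by (intro inner_ratio_mono) auto
    also have "\<dots> \<le> h" using h yC by (simp add: divide_le_eq)
    finally show "p 0 * (1 + p (Suc 0) + p (Suc 0) * p (Suc (Suc 0))) / (1 + p 0 + p 0 * p (Suc 0)) \<le> h" .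
  qed (use bx h0 in auto)
  \<comment> \<open>With all three ratios at most C the inner ratio is at most C itself, by
    \<open>inner_ratio_diag\<close>.\<close>
  have later: "p (Suc (Suc j)) - m (Suc (Suc j)) \<le> real d * C ^ (d - 1) * ((1 + C + C\<^sup>2) + B) * s" for j
  proof -
    have "p (Suc j) * (1 + p (Suc (Suc j)) + p (Suc (Suc j)) * p (Suc (Suc (Suc j))))
        / (1 + p (Suc j) + p (Suc j) * p (Suc (Suc j))) \<le> C * (1 + C + C * C) / (1 + C + C * C)"
      using bx p_nonneg by (intro inner_ratio_mono) auto
    then have "p (Suc (Suc j)) - m (Suc (Suc j))
        \<le> real d * C ^ (d - 1) * ((1 + C + C\<^sup>2) / (1 + 0)\<^sup>2 * (p (Suc j) - m (Suc j)) + B * s)"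
      using nn m_nonneg by (intro step) (auto simp: inner_ratio_diag)
    also have "\<dots> \<le> real d * C ^ (d - 1) * ((1 + C + C\<^sup>2) / (1 + 0)\<^sup>2 * s + B * s)"
      using nn le B0 by (intro mult_left_mono add_mono) auto
    finally show ?thesis by (simp add: algebra_simps)
  qed
  have all: "p (Suc j) - m (Suc j) \<le> max (real d * h ^ (d - 1) * ((1 + C + C\<^sup>2) / (1 + x)\<^sup>2 * E + B * s))
      (real d * C ^ (d - 1) * ((1 + C + C\<^sup>2) + B) * s)" for j
    using first later by (cases j) (auto simp: le_max_iff_disj)
  have "s \<le> max (real d * h ^ (d - 1) * ((1 + C + C\<^sup>2) / (1 + x)\<^sup>2 * E + B * s))
      (real d * C ^ (d - 1) * ((1 + C + C\<^sup>2) + B) * s)"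
    by (subst s_def) (rule cSUP_least[OF _ all], simp)
  then consider (first) "s \<le> real d * h ^ (d - 1) * ((1 + C + C\<^sup>2) / (1 + x)\<^sup>2 * E + B * s)"
    | (later) "s \<le> real d * C ^ (d - 1) * ((1 + C + C\<^sup>2) + B) * s"
    by (auto simp: le_max_iff_disj)
  then have "s \<le> \<kappa> * E"
  proof cases
    case first
    have "(1 - real d * h ^ (d - 1) * B) * s \<le> real d * h ^ (d - 1) * ((1 + C + C\<^sup>2) / (1 + x)\<^sup>2) * E"
      using first by (simp add: algebra_simps)
    also have "\<dots> \<le> ((1 - real d * h ^ (d - 1) * B) * \<kappa>) * E"
      using \<kappa> E0 by (intro mult_right_mono) (simp_all add: B_def algebra_simps)
    finally have "(1 - real d * h ^ (d - 1) * B) * s \<le> (1 - real d * h ^ (d - 1) * B) * (\<kappa> * E)"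
      by (simp add: mult.assoc)
    moreover have "1 - real d * h ^ (d - 1) * B > 0" using b by (simp add: B_def)
    ultimately show ?thesis by (simp only: mult_le_cancel_left_pos)
  next
    case later
    have "s = 0"
    proof (rule ccontr)
      assume "s \<noteq> 0"
      then have "s > 0" using s0 by simp
      then have "real d * C ^ (d - 1) * ((1 + C + C\<^sup>2) + B) * s < 1 * s"
        using t unfolding B_def[symmetric] by (intro mult_strict_right_mono) auto
      with later show False by simp
    qed
    then show ?thesis using E0 \<kappa> by simp
  qed
  then show ?thesis using le[of i] by (simp add: E_def)
qed

text \<open>With \<open>\<sigma> = (m\<^sub>0 + p\<^sub>0)/2\<close>, \<open>\<delta> = (p\<^sub>0 - m\<^sub>0)/2\<close> and \<open>\<Sigma> = 1 + 3\<sigma> + 2m\<^sub>0p\<^sub>0\<close>, the root equations without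
  their tail terms say \<open>artanh (\<delta>/\<sigma>) \<le> d artanh (\<delta>/\<Sigma>)\<close>, and \<open>artanh (\<delta>/\<Sigma>) \<le> (\<sigma>/\<Sigma>) artanh (\<delta>/\<sigma>)\<close>;
  so \<open>d\<sigma> < \<Sigma>\<close> forces \<open>\<delta> = 0\<close>. The tail costs the factor \<open>1 - \<epsilon>\<close>. The resulting inequality is affine in
  \<open>m\<^sub>0\<close> and in \<open>p\<^sub>0\<close>, hence it suffices to check the corners of the box.\<close>

lemma box_certificate:
  assumes box: "box x y C"
    and h: "y * (1 + C + C * C) \<le> h * (1 + y + y * C)"
    and t: "real d * C ^ (d - 1) * ((1 + C + C\<^sup>2) + ((1 + 2 * C) / 4 + C / 2)) < 1"
    and b: "real d * h ^ (d - 1) * ((1 + 2 * C) / 4 + C / 2) < 1"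
    and \<kappa>: "real d * h ^ (d - 1) * ((1 + C + C\<^sup>2) / (1 + x)\<^sup>2 + \<kappa> * ((1 + 2 * C) / 4 + C / 2)) \<le> \<kappa>"
      "0 \<le> \<kappa>"
    and u: "0 \<le> u" "(1 + u + u * C) ^ d \<le> u * (1 + 2 * u) ^ d"
    and \<epsilon>: "real d * \<kappa> * (u / (1 + u)) * ((u + y) / 2) \<le> \<epsilon>"
    and corners: "\<forall>a\<in>{x, u}. \<forall>b\<in>{x, y}.
      0 < (1 - \<epsilon>) * (1 + 3 * ((a + b) / 2) + 2 * a * b) - real d * ((a + b) / 2)"
  shows "p i = m i"
proof -
  have bx: "0 \<le> x" "x \<le> m 0" "p 0 \<le> y" "y \<le> 1" "\<And>i. p (Suc i) \<le> C" "C \<le> y"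
    using box by (auto simp: box_def)
  have "0 < m 0"
    using m_nonneg p_nonneg by (subst m_0) (auto intro!: zero_less_power divide_pos_pos add_pos_nonneg)
  then have "0 < p 0" using m_le_p[of 0] by linarith
  \<comment> \<open>The condition on u says that the decreasing root map sends u below u. If
    \<open>m 0\<close> exceeded u, then \<open>p 0\<close> would be at most u, hence below
    \<open>m 0\<close>.\<close>
  have mu: "m 0 \<le> u"
  proof (rule ccontr)
    assume "\<not> m 0 \<le> u"
    have "p 0 \<le> u" using \<open>\<not> m 0 \<le> u\<close> bx(4,6) bx(5)[of 0] u by (intro p_0_le[of u C]) auto
    with \<open>\<not> m 0 \<le> u\<close> m_le_p[of 0] show False by linarith
  qed
  define \<sigma> where "\<sigma> = (m 0 + p 0) / 2"
  define \<Sigma> where "\<Sigma> = 1 + 3 * \<sigma> + 2 * m 0 * p 0"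
  define \<delta> where "\<delta> = (p 0 - m 0) / 2"
  have \<sigma>: "0 < \<sigma>" and \<delta>: "0 \<le> \<delta>" "\<delta> < \<sigma>"
    using \<open>0 < m 0\<close> \<open>0 < p 0\<close> m_le_p[of 0] by (auto simp: \<sigma>_def \<delta>_def)
  have "0 \<le> m 0 * p 0" using \<open>0 < m 0\<close> \<open>0 < p 0\<close> by simp
  then have \<Sigma>: "\<sigma> \<le> \<Sigma>" "0 < \<Sigma>" using \<sigma> by (auto simp: \<Sigma>_def)
  define D where "D = artanh (\<delta> / \<sigma>)"
  have D: "\<delta> / \<sigma> \<le> D" unfolding D_def using \<sigma> \<delta> by (intro artanh_ge_self) auto
  have "0 \<le> \<delta> / \<sigma>" using \<sigma> \<delta> by simp
  with D have "0 \<le> D" by linarith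
  have ln_pm: "ln (p 0) - ln (m 0) = 2 * D"
  proof -
    have "\<sigma> + \<delta> = p 0" "\<sigma> - \<delta> = m 0" by (simp_all add: \<sigma>_def \<delta>_def field_simps)
    then have "1 + \<delta> / \<sigma> = p 0 / \<sigma>" "1 - \<delta> / \<sigma> = m 0 / \<sigma>"
      using \<sigma> by (simp_all add: field_simps)
    then have "(1 + \<delta> / \<sigma>) / (1 - \<delta> / \<sigma>) = p 0 / m 0"
      using \<sigma> by simp
    then show ?thesis using \<open>0 < m 0\<close> \<open>0 < p 0\<close> by (simp add: D_def artanh_def ln_div)
  qed
  have pos: "0 < 1 + m 0" "0 < 1 + p 0" "0 < 1 + 2 * m 0" "0 < 1 + 2 * p 0"
    "0 < 1 + m 0 + m 0 * p 1" "0 < 1 + p 0 + p 0 * m 1"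
    using m_nonneg p_nonneg by (auto intro!: add_pos_nonneg)
  define q where "q = m 0 / (1 + m 0)"
  have q: "0 \<le> q" "q \<le> u / (1 + u)" "q \<le> p 0 / (1 + p 0)"
    using m_nonneg[of 0] mu m_le_p[of 0] pos by (auto simp: q_def field_simps)
  \<comment> \<open>This separates the tail ratio from the root terms, which are then free to
    combine into one artanh.\<close>
  have ln_split: "ln (1 + a + a * b) = ln (1 + a) + ln (1 + a / (1 + a) * b)" if "0 \<le> a" "0 \<le> b" for a b :: real
  proof -
    have "1 + a + a * b = (1 + a) * (1 + a / (1 + a) * b)" using that by (simp add: field_simps)
    moreover have "0 < 1 + a / (1 + a) * b" using that by (auto intro!: add_pos_nonneg mult_nonneg_nonneg)
    ultimately show ?thesis using that by (simp add: ln_mult)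
  qed
  have "ln (p 0) - ln (m 0) = real d * ((ln (1 + m 0 + m 0 * p 1) - ln (1 + 2 * m 0))
      - (ln (1 + p 0 + p 0 * m 1) - ln (1 + 2 * p 0)))"
  proof -
    have "ln (p 0) = real d * (ln (1 + m 0 + m 0 * p 1) - ln (1 + 2 * m 0))"
      using pos by (subst p_0) (simp add: ln_realpow ln_div)
    moreover have "ln (m 0) = real d * (ln (1 + p 0 + p 0 * m 1) - ln (1 + 2 * p 0))"
      using pos by (subst m_0) (simp add: ln_realpow ln_div)
    ultimately show ?thesis by (simp add: algebra_simps)
  qed
  also have "\<dots> = real d * ((ln (1 + m 0) + ln (1 + 2 * p 0) - ln (1 + 2 * m 0) - ln (1 + p 0))
      + (ln (1 + q * p 1) - ln (1 + p 0 / (1 + p 0) * m 1)))"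
    using m_nonneg[of 0] m_nonneg[of 1] p_nonneg[of 0] p_nonneg[of 1] by (simp add: ln_split q_def)
  also have "\<dots> \<le> real d * (2 * (\<sigma> / \<Sigma> * D) + q * (\<kappa> * (2 * \<delta>)))"
  proof (intro mult_left_mono add_mono)
    \<comment> \<open>This explains the choice of \<Sigma>: the two root products have mean \<Sigma>
      and half-difference \<delta>, the same \<delta> as for \<open>p 0\<close> and
      \<open>m 0\<close>.\<close>
    have prods: "\<Sigma> + \<delta> = (1 + m 0) * (1 + 2 * p 0)" "\<Sigma> - \<delta> = (1 + 2 * m 0) * (1 + p 0)"
      by (simp_all add: \<Sigma>_def \<sigma>_def \<delta>_def field_simps)
    have "ln (\<Sigma> + \<delta>) = ln (1 + m 0) + ln (1 + 2 * p 0)" "ln (\<Sigma> - \<delta>) = ln (1 + 2 * m 0) + ln (1 + p 0)"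
      unfolding prods using pos by (simp_all only: ln_mult_pos)
    then have "ln (1 + m 0) + ln (1 + 2 * p 0) - ln (1 + 2 * m 0) - ln (1 + p 0)
        = ln (\<Sigma> + \<delta>) - ln (\<Sigma> - \<delta>)" by linarith
    also have "\<dots> = 2 * artanh (\<delta> / \<Sigma>)"
    proof -
      have "(1 + \<delta> / \<Sigma>) / (1 - \<delta> / \<Sigma>) = (\<Sigma> + \<delta>) / (\<Sigma> - \<delta>)"
        using \<Sigma> \<delta> by (simp add: field_simps)
      then show ?thesis using \<Sigma> \<delta> by (simp add: artanh_def ln_div)
    qed
    also have "\<delta> / \<Sigma> = \<sigma> / \<Sigma> * (\<delta> / \<sigma>)" using \<sigma> by simp
    also have "2 * artanh (\<sigma> / \<Sigma> * (\<delta> / \<sigma>)) \<le> 2 * (\<sigma> / \<Sigma> * D)"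
      unfolding D_def using \<sigma> \<Sigma> \<delta> by (intro mult_left_mono artanh_scale) auto
    finally show "ln (1 + m 0) + ln (1 + 2 * p 0) - ln (1 + 2 * m 0) - ln (1 + p 0) \<le> 2 * (\<sigma> / \<Sigma> * D)" .
    have qm: "0 \<le> q * m 1" "0 \<le> q * p 1" using q m_nonneg p_nonneg by simp_all
    \<comment> \<open>The larger factor \<open>p 0 / (1 + p 0)\<close> may be lowered to q; then ln
      t \<le> t - 1 bounds the remaining difference of logarithms by
      \<open>q * (p 1 - m 1)\<close>.\<close>
    have "ln (1 + q * m 1) \<le> ln (1 + p 0 / (1 + p 0) * m 1)"
      using q qm m_nonneg[of 1] by (intro ln_mono add_mono mult_right_mono) (auto intro!: add_pos_nonneg)
    moreover have "ln (1 + q * p 1) - ln (1 + q * m 1) = ln ((1 + q * p 1) / (1 + q * m 1))"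
      using qm by (subst ln_div) auto
    moreover have "\<dots> \<le> (1 + q * p 1) / (1 + q * m 1) - 1"
      using qm by (intro ln_le_minus_one divide_pos_pos) auto
    moreover have "(1 + q * p 1) / (1 + q * m 1) - 1 = (q * (p 1 - m 1)) / (1 + q * m 1)"
      using qm by (simp add: field_simps)
    moreover have "\<dots> \<le> q * (p 1 - m 1) / 1"
      using qm q m_le_p[of 1] by (intro divide_left_mono) auto
    moreover have "q * (p 1 - m 1) \<le> q * (\<kappa> * (2 * \<delta>))"
    proof (intro mult_left_mono)
      have "2 * \<delta> = p 0 - m 0" by (simp add: \<delta>_def)
      then show "p 1 - m 1 \<le> \<kappa> * (2 * \<delta>)" using tail_diff_le[OF box h t b \<kappa>, of 0] by simp
    qed (use q in simp)
    ultimately show "ln (1 + q * p 1) - ln (1 + p 0 / (1 + p 0) * m 1) \<le> q * (\<kappa> * (2 * \<delta>))"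
      by linarith
  qed auto
  also have "\<dots> = 2 * (real d * (\<sigma> / \<Sigma> * D) + real d * \<kappa> * q * \<delta>)"
    by (simp add: algebra_simps)
  finally have main: "D \<le> real d * (\<sigma> / \<Sigma> * D) + real d * \<kappa> * q * \<delta>"
    unfolding ln_pm by simp
  \<comment> \<open>Since \<delta> \<le> \<sigma> D, the tail term too becomes a multiple of
    D.\<close>
  have "real d * \<kappa> * q * \<delta> \<le> real d * \<kappa> * (u / (1 + u)) * (((u + y) / 2) * D)"
  proof (intro mult_mono)
    have "\<delta> \<le> \<sigma> * D" using D \<sigma> by (simp add: divide_le_eq mult.commute)
    also have "\<dots> \<le> (u + y) / 2 * D"
      using mu bx \<open>0 \<le> D\<close> by (intro mult_right_mono) (auto simp: \<sigma>_def)
    finally show "\<delta> \<le> (u + y) / 2 * D" .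
  qed (use q \<kappa> u \<delta> in auto)
  also have "\<dots> = real d * \<kappa> * (u / (1 + u)) * ((u + y) / 2) * D" by simp
  also have "\<dots> \<le> \<epsilon> * D" using \<epsilon> \<open>0 \<le> D\<close> by (rule mult_right_mono)
  finally have "(1 - \<epsilon>) * D \<le> real d * (\<sigma> / \<Sigma>) * D" using main by (simp add: algebra_simps)
  then have "\<Sigma> * ((1 - \<epsilon>) * D) \<le> \<Sigma> * (real d * (\<sigma> / \<Sigma>) * D)" using \<Sigma> by (intro mult_left_mono) auto
  then have D_le: "((1 - \<epsilon>) * \<Sigma> - real d * \<sigma>) * D \<le> 0" using \<Sigma> by (simp add: field_simps)
  have "0 < (1 - \<epsilon>) * \<Sigma> - real d * \<sigma>"
  proof -
    define L where "L = (\<lambda>a b. (1 - \<epsilon>) * (1 + 3 * ((a + b) / 2) + 2 * a * b) - real d * ((a + b) / 2))"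
    have L1: "L a b = (1 - \<epsilon>) * (1 + 3 * b / 2) - real d * b / 2
        + ((1 - \<epsilon>) * (3 / 2 + 2 * b) - real d / 2) * a" for a b
      by (simp add: L_def algebra_simps add_divide_distrib)
    have L2: "L a b = (1 - \<epsilon>) * (1 + 3 * a / 2) - real d * a / 2
        + ((1 - \<epsilon>) * (3 / 2 + 2 * a) - real d / 2) * b" for a b
      by (simp add: L_def algebra_simps add_divide_distrib)
    have c: "0 < L a b" if "a \<in> {x, u}" "b \<in> {x, y}" for a b
      using corners[rule_format, OF that] by (simp add: L_def)
    \<comment> \<open>First \<open>m 0\<close> varies in [x, u] with the other argument at an
      endpoint, then \<open>p 0\<close> varies in [x, y]; x bounds \<open>p 0\<close> because
      \<open>m 0\<close> \<le> \<open>p 0\<close>.\<close>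
    have "0 < L (m 0) b" if "b \<in> {x, y}" for b
      by (rule affine_pos_between[OF L1, of x b u "m 0"]) (use c that bx mu in auto)
    then have "0 < L (m 0) (p 0)"
      by (intro affine_pos_between[OF L2, of "m 0" x y "p 0"]) (use bx m_le_p[of 0] in auto)
    then show ?thesis by (simp add: L_def \<Sigma>_def \<sigma>_def)
  qed
  with D_le \<open>0 \<le> D\<close> have "D = 0" by (simp add: mult_le_0_iff)
  with D \<sigma> \<delta> have "\<delta> \<le> 0" by (simp add: divide_le_0_iff)
  then have "p 0 - m 0 = 0" using \<delta> by (simp add: \<delta>_def)
  show ?thesis
  proof (cases i)
    case (Suc j)
    then show ?thesis
      using tail_diff_le[OF box h t b \<kappa>, of j] m_le_p[of i] \<open>p 0 - m 0 = 0\<close> by simp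
  qed (use \<open>p 0 - m 0 = 0\<close> in simp)
qed

text \<open>The numbers come from interval iteration: starting from the trivial box, each step evaluates the
  monotone bounds of \<open>box_step\<close> and rounds outwards, until \<open>box_certificate\<close> applies. The case \<open>d = 7\<close>
  is nearly critical: the linearisation at the fixed point has slope about \<open>-0.957\<close>, and for \<open>d = 8\<close>
  it is below \<open>-1\<close>.\<close>

lemma unique_2:
  assumes "d = 2"
  shows "p i = m i"
proof -
  have "box 0.444 0.775 0.49"
    by (rule box_step[OF box_start]) (simp_all add: assms power_divide)
  then have "box 0.484 0.722 0.388"
    by (rule box_step) (simp_all add: assms power_divide)
  then have "box 0.496 0.686 0.308"
    by (rule box_step) (simp_all add: assms power_divide)
  then have "box 0.505 0.662 0.258"
    by (rule box_step) (simp_all add: assms power_divide)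
  then show ?thesis
    by (rule box_certificate[where h = "0.48" and \<kappa> = "1.096" and u = "0.63" and \<epsilon> = "0.548"])
      (simp_all add: assms power_divide)
qed

lemma unique_3:
  assumes "d = 3"
  shows "p i = m i"
proof -
  have "box 0.296 0.677 0.343"
    by (rule box_step[OF box_start]) (simp_all add: assms power_divide)
  then have "box 0.361 0.551 0.139"
    by (rule box_step) (simp_all add: assms power_divide)
  then show ?thesis
    by (rule box_certificate[where h = "0.4" and \<kappa> = "0.37" and u = "0.49" and \<epsilon> = "0.19"])
      (simp_all add: assms power_divide)
qed

lemma unique_4:
  assumes "d = 4"
  shows "p i = m i"
proof -
  have "box 0.197 0.636 0.241"
    by (rule box_step[OF box_start]) (simp_all add: assms power_divide)
  then have "box 0.268 0.483 0.046"
    by (rule box_step) (simp_all add: assms power_divide)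
  then show ?thesis
    by (rule box_certificate[where h = "0.34" and \<kappa> = "0.108" and u = "0.4" and \<epsilon> = "0.055"])
      (simp_all add: assms power_divide)
qed

lemma unique_5:
  assumes "d = 5"
  shows "p i = m i"
proof -
  have "box 0.131 0.637 0.169"
    by (rule box_step[OF box_start]) (simp_all add: assms power_divide)
  then show ?thesis
    by (rule box_certificate[where h = "0.44" and \<kappa> = "0.191" and u = "0.38" and \<epsilon> = "0.134"])
      (simp_all add: assms power_divide)
qed

lemma unique_6:
  assumes "d = 6"
  shows "p i = m i"
proof -
  have "box 0.087 0.667 0.118"
    by (rule box_step[OF box_start]) (simp_all add: assms power_divide)
  then have "box 0.132 0.519 0.007"
    by (rule box_step) (simp_all add: assms power_divide)
  then show ?thesis
    by (rule box_certificate[where h = "0.35" and \<kappa> = "0.025" and u = "0.3" and \<epsilon> = "0.015"])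
      (simp_all add: assms power_divide)
qed

lemma unique_7:
  assumes "d = 7"
  shows "p i = m i"
proof -
  have "box 0.058 0.711 0.083"
    by (rule box_step[OF box_start]) (simp_all add: assms power_divide)
  then have "box 0.087 0.585 0.004"
    by (rule box_step) (simp_all add: assms power_divide)
  then have "box 0.11 0.517 0.001"
    by (rule box_step) (simp_all add: assms power_divide)
  \<comment> \<open>From here on the tail bound 0.001 suffices, and only the root interval is
    narrowed.\<close>
  then have "box 0.128 0.472 0.001"
    by (rule box_step) (simp_all add: assms power_divide)
  then have "box 0.142 0.441 0.001"
    by (rule box_step) (simp_all add: assms power_divide)
  then have "box 0.154 0.417 0.001"
    by (rule box_step) (simp_all add: assms power_divide)
  then have "box 0.164 0.398 0.001"
    by (rule box_step) (simp_all add: assms power_divide)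
  then have "box 0.173 0.383 0.001"
    by (rule box_step) (simp_all add: assms power_divide)
  then have "box 0.18 0.371 0.001"
    by (rule box_step) (simp_all add: assms power_divide)
  then have "box 0.187 0.36 0.001"
    by (rule box_step) (simp_all add: assms power_divide)
  then have "box 0.193 0.351 0.001"
    by (rule box_step) (simp_all add: assms power_divide)
  then have "box 0.198 0.344 0.001"
    by (rule box_step) (simp_all add: assms power_divide)
  then have "box 0.202 0.338 0.001"
    by (rule box_step) (simp_all add: assms power_divide)
  then have "box 0.206 0.332 0.001"
    by (rule box_step) (simp_all add: assms power_divide)
  then have "box 0.21 0.327 0.001"
    by (rule box_step) (simp_all add: assms power_divide)
  then have "box 0.213 0.323 0.001"
    by (rule box_step) (simp_all add: assms power_divide)
  then have "box 0.216 0.319 0.001"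
    by (rule box_step) (simp_all add: assms power_divide)
  then have "box 0.219 0.315 0.001"
    by (rule box_step) (simp_all add: assms power_divide)
  then have "box 0.222 0.312 0.001"
    by (rule box_step) (simp_all add: assms power_divide)
  then show ?thesis
    by (rule box_certificate[where h = "0.24" and \<kappa> = "0.0009" and u = "0.27" and \<epsilon> = "0.00039"])
      (simp_all add: assms power_divide)
qed

lemma p_eq_m:
  assumes "d \<le> 7"
  shows "p = m"
proof
  fix i
  have "d \<in> {2, 3, 4, 5, 6, 7}" using d assms by auto
  then show "p i = m i"
    using unique_2 unique_3 unique_4 unique_5 unique_6 unique_7 by blast
qed

end

section \<open>Monotone envelopes\<close>

text \<open>The start consists of the greatest and the least sequence in [0, 1] with tail at most
  \<open>c\<close>, so one pair of envelopes serves all orbits with that tail bound.\<close>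

primrec envelope :: "nat \<Rightarrow> real \<Rightarrow> nat \<Rightarrow> (nat \<Rightarrow> real) \<times> (nat \<Rightarrow> real)" where
  "envelope d c 0 = ((\<lambda>i. if i = 0 then 1 else c), (\<lambda>i. 0))"
| "envelope d c (Suc n) = (case envelope d c n of (p, m) \<Rightarrow> (ratio_step d p m, ratio_step d m p))"

lemma envelope_bounds:
  assumes "2 \<le> d" "1 / 2 \<le> c" "c < 1"
  defines "P \<equiv> \<lambda>n. fst (envelope d c n)" and "M \<equiv> \<lambda>n. snd (envelope d c n)"
  shows "(\<forall>i. 0 \<le> M n i \<and> M n i \<le> P n i \<and> P n i \<le> 1)
    \<and> (\<forall>i. P (Suc n) i \<le> P n i) \<and> (\<forall>i. M n i \<le> M (Suc n) i)"
proof (induction n)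
  case 0
  \<comment> \<open>Coordinate 1 has left neighbour 1 and decreases by
    \<open>inner_ratio_contract\<close>, which requires c \<ge> 1/2; later coordinates become
    \<open>c ^ d\<close>.\<close>
  have "P (Suc 0) i \<le> P 0 i" for i
  proof (cases i)
    case (Suc j)
    show ?thesis
    proof (cases j)
      case 0
      then show ?thesis
        using inner_ratio_contract[OF assms(1-3)] Suc by (simp add: P_def less_imp_le)
    next
      case (Suc k)
      have "c ^ d \<le> c ^ 1" using assms by (intro power_decreasing) auto
      then show ?thesis
        using Suc \<open>i = Suc j\<close> assms inner_ratio_diag[of c] by (simp add: P_def)
    qed
  qed (simp add: P_def)
  moreover have "M 0 i \<le> M (Suc 0) i" for i
    using assms ratio_step_nonneg[of "\<lambda>i. 0" "\<lambda>i. if i = 0 then 1 else c"] by (simp add: M_def)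
  ultimately show ?case using assms by (auto simp: P_def M_def)
next
  case (Suc n)
  have step: "P (Suc k) = ratio_step d (P k) (M k)" "M (Suc k) = ratio_step d (M k) (P k)" for k
    by (simp_all add: P_def M_def split: prod.split)
  have a: "0 \<le> M n i" "M n i \<le> P n i" "P n i \<le> 1" "P (Suc n) i \<le> P n i" "M n i \<le> M (Suc n) i" for i
    using Suc by auto
  have P0: "0 \<le> P n i" for i using a(1,2) order_trans by blast
  have b: "0 \<le> M (Suc n) i" "M (Suc n) i \<le> P (Suc n) i" "P (Suc n) i \<le> 1" for i
  proof -
    show "0 \<le> M (Suc n) i" using a(1,5) order_trans by blast
    show "M (Suc n) i \<le> P (Suc n) i" unfolding step using a by (intro ratio_step_mono) auto
    show "P (Suc n) i \<le> 1" using a(3,4) order_trans by blast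
  qed
  have "P (Suc (Suc n)) i \<le> P (Suc n) i" for i
  proof -
    have "ratio_step d (P (Suc n)) (M (Suc n)) i \<le> ratio_step d (P n) (M n) i"
      using a b order_trans[OF b(1,2)] by (intro ratio_step_mono) auto
    then show ?thesis by (simp only: step)
  qed
  moreover have "M (Suc n) i \<le> M (Suc (Suc n)) i" for i
  proof -
    have "ratio_step d (M n) (P n) i \<le> ratio_step d (M (Suc n)) (P (Suc n)) i"
      using a b order_trans[OF b(1,2)] order_trans[OF b(2,3)] by (intro ratio_step_mono) auto
    then show ?thesis by (simp only: step)
  qed
  ultimately show ?case using b by blast
qed

lemma tendsto_ratio_step:
  assumes "\<And>i. (\<lambda>n. P n i) \<longlonglongrightarrow> p i" "\<And>i. (\<lambda>n. M n i) \<longlonglongrightarrow> m i"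
    and "\<And>i. 0 \<le> p i" "0 \<le> m 0"
  shows "(\<lambda>n. ratio_step d (P n) (M n) i) \<longlonglongrightarrow> ratio_step d p m i"
proof (cases i)
  case 0
  have "1 + 2 * m 0 \<noteq> 0" using assms(4) by linarith
  then show ?thesis unfolding 0 ratio_step_simps by (intro tendsto_intros assms)
next
  case (Suc j)
  have "0 \<le> p j * p (Suc j)" using assms(3) by simp
  then have "1 + p j + p j * p (Suc j) \<noteq> 0" using assms(3)[of j] by linarith
  then show ?thesis unfolding Suc ratio_step_simps by (intro tendsto_intros assms)
qed

text \<open>Both envelopes are monotone and bounded. By continuity their limits form a
  \<open>fixed_pair\<close>, and uniqueness identifies them.\<close>

lemma envelope_limit:
  assumes "2 \<le> d" "d \<le> 7" "1 / 2 \<le> c" "c < 1"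
  obtains l where "\<And>i. (\<lambda>n. fst (envelope d c n) i) \<longlonglongrightarrow> l i"
    and "\<And>i. (\<lambda>n. snd (envelope d c n) i) \<longlonglongrightarrow> l i"
proof -
  define P where "P = (\<lambda>n. fst (envelope d c n))"
  define M where "M = (\<lambda>n. snd (envelope d c n))"
  have bnd: "0 \<le> M n i" "M n i \<le> P n i" "P n i \<le> 1" "P (Suc n) i \<le> P n i" "M n i \<le> M (Suc n) i" for n i
    using envelope_bounds[OF assms(1,3,4), of n] by (auto simp: P_def M_def)
  have step: "P (Suc k) = ratio_step d (P k) (M k)" "M (Suc k) = ratio_step d (M k) (P k)" for k
    by (simp_all add: P_def M_def split: prod.split)
  have "decseq (\<lambda>n. P n i)" "incseq (\<lambda>n. M n i)" for i
    using bnd by (auto intro: decseq_SucI incseq_SucI)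
  have "convergent (\<lambda>n. P n i)" for i
    using decseq_convergent[OF \<open>decseq (\<lambda>n. P n i)\<close>, of 0] order_trans[OF bnd(1,2)]
    by (meson convergentI)
  moreover have "convergent (\<lambda>n. M n i)" for i
    using incseq_convergent[OF \<open>incseq (\<lambda>n. M n i)\<close>, of 1] order_trans[OF bnd(2,3)]
    by (meson convergentI)
  ultimately obtain p m where lim: "\<And>i. (\<lambda>n. P n i) \<longlonglongrightarrow> p i" "\<And>i. (\<lambda>n. M n i) \<longlonglongrightarrow> m i"
    unfolding convergent_def by metis
  have m0: "0 \<le> m i" for i using bnd by (intro LIMSEQ_le_const[OF lim(2)]) auto
  have mp: "m i \<le> p i" for i using bnd by (intro LIMSEQ_le[OF lim(2) lim(1)]) auto
  have p1: "p i \<le> 1" for i using bnd by (intro LIMSEQ_le_const2[OF lim(1)]) auto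
  have p0: "0 \<le> p i" for i using m0 mp order_trans by blast
  have pc: "p (Suc i) \<le> c" for i
  proof -
    have "P n (Suc i) \<le> P 0 (Suc i)" for n
      using \<open>decseq (\<lambda>n. P n (Suc i))\<close> by (simp add: decseq_def)
    then show ?thesis by (intro LIMSEQ_le_const2[OF lim(1)]) (auto simp: P_def)
  qed
  interpret fixed_pair d p m c
  proof
    show "p i = ratio_step d p m i" for i
      using LIMSEQ_Suc[OF lim(1)[of i]] tendsto_ratio_step[OF lim p0 m0, where d = d and i = i]
      unfolding step by (rule LIMSEQ_unique)
    show "m i = ratio_step d m p i" for i
      using LIMSEQ_Suc[OF lim(2)[of i]] tendsto_ratio_step[OF lim(2) lim(1) m0 p0, where d = d and i = i]
      unfolding step by (rule LIMSEQ_unique)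
  qed (use assms m0 mp p1 pc in auto)
  have "p = m" by (rule p_eq_m[OF assms(2)])
  with lim show thesis by (intro that[of p]) (auto simp: P_def M_def)
qed

section \<open>Orbits of the ratio map\<close>

definition orbit :: "nat \<Rightarrow> (nat \<Rightarrow> nat \<Rightarrow> real) \<Rightarrow> bool" where
  "orbit d a \<longleftrightarrow> (\<forall>n. a (Suc n) = ratio_step d (a n) (a n)) \<and> (\<forall>i. 0 \<le> a 0 i \<and> a 0 i \<le> 1)"

lemma orbit_shift:
  assumes "orbit d a" shows "orbit d (\<lambda>n. a (n + N))"
proof -
  have "0 \<le> a n i \<and> a n i \<le> 1" for n i
  proof (induction n arbitrary: i)
    case 0
    then show ?case using assms by (simp add: orbit_def)
  next
    case (Suc n)
    have st: "a (Suc n) = ratio_step d (a n) (a n)" using assms by (simp add: orbit_def)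
    \<comment> \<open>The pair (1, 0) dominates every pair with ratios in [0, 1], and its step is
      the constant 1.\<close>
    have "ratio_step d (a n) (a n) i \<le> ratio_step d (\<lambda>i. 1) (\<lambda>i. 0) i"
      using Suc by (intro ratio_step_mono) auto
    also have "\<dots> = 1" by (cases i) auto
    finally show ?case unfolding st using Suc by (auto intro!: ratio_step_nonneg)
  qed
  then show ?thesis using assms by (simp add: orbit_def)
qed

lemma orbit_bounds:
  assumes "orbit d a" shows "0 \<le> a n i" "a n i \<le> 1"
  using orbit_shift[OF assms, of n] by (auto simp: orbit_def)

lemma orbit_envelope:
  assumes "orbit d a" "2 \<le> d" "1 / 2 \<le> c" "c < 1" "\<And>i. a 0 (Suc i) \<le> c"
  shows "snd (envelope d c n) i \<le> a n i" "a n i \<le> fst (envelope d c n) i"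
proof (induction n arbitrary: i)
  case 0
  {
    case 1 then show ?case using assms(1) by (simp add: orbit_def)
  next
    case 2 then show ?case using assms by (cases i) (auto simp: orbit_def)
  }
next
  case (Suc n)
  have st: "a (Suc n) = ratio_step d (a n) (a n)" using assms by (simp add: orbit_def)
  obtain p m where e: "envelope d c n = (p, m)" by (cases "envelope d c n")
  have b: "0 \<le> m i" "p i \<le> 1" for i
    using envelope_bounds[OF assms(2-4), of n] e by auto
  have IH: "m i \<le> a n i" "a n i \<le> p i" for i using Suc e by auto
  {
    case 1
    show ?case unfolding st using e b IH orbit_bounds[OF assms(1)]
      by (auto intro!: ratio_step_mono)
  next
    case 2
    show ?case unfolding st using e b IH orbit_bounds[OF assms(1)]
      by (auto intro!: ratio_step_mono)
  }
qed

text \<open>A ratio bounded away from 1 pulls its left neighbour away from 1 in one step, except at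
  the root. After k steps the plateau of ratios near 1 has been eaten up from the right.\<close>

lemma orbit_plateau_shrinks:
  assumes "orbit d a" "2 \<le> d" "1 / 2 \<le> c" "c < 1" "\<And>i. k < i \<Longrightarrow> a 0 i \<le> c"
  obtains N c' where "1 / 2 \<le> c'" "c' < 1" "\<And>i. a N (Suc i) \<le> c'"
proof -
  have "\<exists>N c'. 1 / 2 \<le> c' \<and> c' < 1 \<and> (\<forall>i. a N (Suc i) \<le> c')"
    using assms
  proof (induction k arbitrary: a c)
    case 0
    then show ?case by blast
  next
    case (Suc k)
    have ab: "0 \<le> a 0 i" "a 0 i \<le> 1" for i using orbit_bounds[OF Suc.prems(1)] by auto
    have "\<exists>N c'. 1 / 2 \<le> c' \<and> c' < 1 \<and> (\<forall>i. a (N + 1) (Suc i) \<le> c')"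
    \<comment> \<open>The new bound is the inner ratio with its first two arguments 1 and its right
      neighbour \<open>c\<close>.\<close>
    proof (rule Suc.IH[of "\<lambda>n. a (n + 1)" "(2 + c) / 3"])
      show "orbit d (\<lambda>n. a (n + 1))" by (rule orbit_shift[OF Suc.prems(1)])
      fix i assume "k < i"
      then obtain j where i: "i = Suc j" by (cases i) auto
      have "a (Suc 0) i = (a 0 j * (1 + a 0 (Suc j) + a 0 (Suc j) * a 0 (Suc (Suc j)))
          / (1 + a 0 j + a 0 j * a 0 (Suc j))) ^ d"
        using Suc.prems(1) by (simp add: orbit_def i)
      also have "\<dots> \<le> (1 * (1 + 1 + 1 * c) / (1 + 1 + 1 * 1)) ^ d"
        using ab Suc.prems(5)[of "Suc (Suc j)"] \<open>k < i\<close> i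
        by (intro power_mono inner_ratio_mono inner_ratio_nonneg) auto
      also have "\<dots> \<le> (1 * (1 + 1 + 1 * c) / (1 + 1 + 1 * 1)) ^ 1"
        using Suc.prems by (intro power_decreasing) auto
      finally show "a (0 + 1) i \<le> (2 + c) / 3" by simp
    qed (use Suc.prems in auto)
    then show ?case by blast
  qed
  with that show thesis by blast
qed

theorem orbit_convergence:
  assumes "2 \<le> d" "d \<le> 7"
  shows "\<exists>l. \<forall>a. orbit d a \<and> (\<exists>k. \<exists>c<1. \<forall>i>k. a 0 i \<le> c) \<longrightarrow> (\<forall>i. (\<lambda>n. a n i) \<longlonglongrightarrow> l i)"
proof -
  \<comment> \<open>The orbit of the zero sequence satisfies every tail bound, so it links the
    limits obtained for different values of \<open>c\<close>.\<close>
  define z :: "nat \<Rightarrow> nat \<Rightarrow> real" where "z = (\<lambda>n. ((\<lambda>a. ratio_step d a a) ^^ n) (\<lambda>i. 0))"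
  have z: "orbit d z" by (simp add: orbit_def z_def)
  have sandwich: "\<exists>l. \<forall>a. orbit d a \<and> (\<forall>i. a 0 (Suc i) \<le> c) \<longrightarrow> (\<forall>i. (\<lambda>n. a n i) \<longlonglongrightarrow> l i)"
    if c: "1 / 2 \<le> c" "c < 1" for c
  proof -
    obtain l where l: "\<And>i. (\<lambda>n. fst (envelope d c n) i) \<longlonglongrightarrow> l i"
      "\<And>i. (\<lambda>n. snd (envelope d c n) i) \<longlonglongrightarrow> l i"
      using envelope_limit[OF assms c] by blast
    have "(\<lambda>n. a n i) \<longlonglongrightarrow> l i" if "orbit d a" "\<And>i. a 0 (Suc i) \<le> c" for a i
      by (rule tendsto_sandwich[OF _ _ l(2) l(1)])
        (use orbit_envelope[OF that(1) assms(1) c that(2)] in auto)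
    then show ?thesis by blast
  qed
  obtain l where l: "\<And>i. (\<lambda>n. z n i) \<longlonglongrightarrow> l i"
  proof -
    have "\<forall>i. z 0 (Suc i) \<le> 1 / 2" by (simp add: z_def)
    then show thesis using sandwich[of "1 / 2"] z that by force
  qed
  have "(\<lambda>n. a n i) \<longlonglongrightarrow> l i"
    if a: "orbit d a" "c < 1" "\<And>i. k < i \<Longrightarrow> a 0 i \<le> c" for a k c i
  proof -
    \<comment> \<open>The envelope lemmas require a bound of at least 1/2.\<close>
    have le: "a 0 i \<le> max c (1 / 2)" if "k < i" for i using a(3)[OF that] by simp
    obtain N c' where c': "1 / 2 \<le> c'" "c' < 1" "\<And>i. a N (Suc i) \<le> c'"
      by (rule orbit_plateau_shrinks[OF a(1) assms(1), of "max c (1 / 2)" k]) (use a(2) le in auto)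
    obtain l' where l': "\<And>a i. orbit d a \<Longrightarrow> (\<And>i. a 0 (Suc i) \<le> c') \<Longrightarrow> (\<lambda>n. a n i) \<longlonglongrightarrow> l' i"
      using sandwich[OF c'(1,2)] by blast
    have "l' i = l i"
      by (rule LIMSEQ_unique[OF l'[OF z] l]) (use c' in \<open>simp add: z_def\<close>)
    moreover have "(\<lambda>n. a (n + N) i) \<longlonglongrightarrow> l' i"
      by (rule l'[OF orbit_shift[OF a(1)]]) (use c' in simp)
    ultimately show ?thesis by (simp add: LIMSEQ_offset)
  qed
  then show ?thesis by blast
qed

text \<open>Once the whole tail lies below c', it stays there, because the upper envelope decreases
  from c'. The bound is uniform in n, as a dominating function requires.\<close>

lemma orbit_eventually_contracting:
  assumes "orbit d a" "2 \<le> d" "c < 1" "\<And>i. k < i \<Longrightarrow> a 0 i \<le> c"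
  obtains c' N where "0 \<le> c'" "c' < 1" "\<And>n i. N \<le> n \<Longrightarrow> a n (Suc i) \<le> c'"
proof -
  have le: "a 0 i \<le> max c (1 / 2)" if "k < i" for i using assms(4)[OF that] by simp
  obtain N c' where c': "1 / 2 \<le> c'" "c' < 1" "\<And>i. a N (Suc i) \<le> c'"
    by (rule orbit_plateau_shrinks[OF assms(1,2), of "max c (1 / 2)" k]) (use assms(3) le in auto)
  have "a (n + N) (Suc i) \<le> c'" for n i
  proof -
    have "decseq (\<lambda>n. fst (envelope d c' n) (Suc i))"
      using envelope_bounds[OF assms(2) c'(1,2)] by (auto intro: decseq_SucI)
    then have "fst (envelope d c' n) (Suc i) \<le> fst (envelope d c' 0) (Suc i)"
      unfolding decseq_def by blast
    then show ?thesis
      using orbit_envelope(2)[OF orbit_shift[OF assms(1)] assms(2) c'(1,2), of N n "Suc i"] c' by simp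
  qed
  then have "a n (Suc i) \<le> c'" if "N \<le> n" for n i
    using that by (metis le_add_diff_inverse2)
  with c' show thesis by (intro that[of c' N]) auto
qed

section \<open>Summation over the leaves\<close>

definition weight_step :: "nat \<Rightarrow> (int \<Rightarrow> real) \<Rightarrow> int \<Rightarrow> real" where
  "weight_step d w i = (w (i - 1) + w i + w (i + 1)) ^ d"

lemma weight_step_nonneg: "(\<And>i. 0 \<le> w i) \<Longrightarrow> 0 \<le> weight_step d w i"
  by (simp add: weight_step_def)

text \<open>A sum of three neighbouring weights is bounded by some B, so its d-th power is at most
  \<open>B ^ (d - 1)\<close> times the sum itself.\<close>

lemma weight_step_summable:
  assumes "0 < d" "\<And>i. 0 \<le> w i" "w summable_on UNIV"
  shows "weight_step d w summable_on UNIV"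
proof -
  define s where "s = (\<lambda>i. w (i - 1) + w i + w (i + 1))"
  define B where "B = 3 * infsum w UNIV"
  have "(\<lambda>i. w (i + k)) summable_on UNIV" for k
    using assms(3) summable_on_reindex_bij_betw[of "\<lambda>i. i + k" UNIV UNIV w]
      bij_betw_byWitness[of UNIV "\<lambda>i. i - k" "\<lambda>i. i + k" UNIV] by auto
  from this[of "-1"] this[of 1] have s: "s summable_on UNIV"
    unfolding s_def using assms(3) by (intro summable_on_add) auto
  have "w i \<le> infsum w UNIV" for i
    using finite_sum_le_infsum[OF assms(3), of "{i}"] assms(2) by simp
  from add_mono[OF add_mono[OF this this] this] have "s i \<le> B" for i
    unfolding s_def B_def by (simp add: algebra_simps)
  moreover have s0: "0 \<le> s i" for i using assms(2) by (simp add: s_def)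
  ultimately have "s i ^ (d - 1) * s i \<le> B ^ (d - 1) * s i" for i
    by (intro mult_right_mono power_mono)
  moreover have "weight_step d w i = s i ^ (d - 1) * s i" for i
    using assms(1) by (simp add: weight_step_def s_def flip: power_Suc2)
  ultimately show ?thesis
    using s0 by (intro summable_on_comparison_test[OF summable_on_cmult_right[OF s, of "B ^ (d - 1)"]]) auto
qed

lemma finite_tree_leaves: "finite (tree_leaves n d)"
  by (rule finite_subset[OF _ finite_lists_length_eq[of "{..<d}" n]])
    (auto simp: tree_leaves_def tree_verts_def)

lemma prod_tree_leaves_Suc:
  "(\<Prod>v\<in>tree_leaves (Suc n) d. h (butlast v)) = (\<Prod>v\<in>tree_leaves n d. h v ^ d :: real)"
proof -
  have "(\<Prod>v\<in>tree_leaves n d. h v ^ d) = (\<Prod>v\<in>tree_leaves n d. \<Prod>i<d. h v)" by simp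
  also have "\<dots> = (\<Prod>(v, i)\<in>tree_leaves n d \<times> {..<d}. h v)"
    by (subst prod.Sigma) (auto simp: finite_tree_leaves)
  also have "\<dots> = (\<Prod>v\<in>tree_leaves (Suc n) d. h (butlast v))"
  proof (rule prod.reindex_bij_witness[of _ "\<lambda>v. (butlast v, last v)" "\<lambda>(v, i). v @ [i]"], goal_cases)
    case (4 v)
    then have "v \<noteq> []" by (auto simp: tree_leaves_def)
    then have "set v = insert (last v) (set (butlast v))"
      by (metis append_butlast_last_id Un_insert_right list.set sup_bot_right set_append)
    then show ?case using 4 by (auto simp: tree_leaves_def tree_verts_def)
  next
    case (3 v)
    then have "v \<noteq> []" by (auto simp: tree_leaves_def)
    then show ?case by simp
  qed (auto simp: tree_leaves_def tree_verts_def)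
  finally show ?thesis by simp
qed

lemma restr_lip_funs: "f \<in> lip_funs n d \<Longrightarrow> r \<le> n \<Longrightarrow> restr r f \<in> lip_funs r d"
  by (auto simp: lip_funs_def restr_def tree_verts_def)

lemma restr_restr: "r \<le> s \<Longrightarrow> restr r (restr s f) = restr r f"
  by (auto simp: restr_def)

text \<open>Extensionality makes the decomposition of a function on depth \<open>Suc n\<close> into
  its restriction and its leaf values a bijection.\<close>

definition leaf_values :: "nat \<Rightarrow> nat \<Rightarrow> (nat list \<Rightarrow> int) \<Rightarrow> (nat list \<Rightarrow> int) set" where
  "leaf_values n d \<phi> = (\<Pi>\<^sub>E v\<in>tree_leaves (Suc n) d. {\<phi> (butlast v) - 1..\<phi> (butlast v) + 1})"

text \<open>The leaves choose their values independently, so the sum factors over them; the d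
  siblings below a vertex contribute equal factors.\<close>

lemma leaf_values_sum:
  "(\<Sum>g\<in>leaf_values n d \<phi>. \<Prod>v\<in>tree_leaves (Suc n) d. w (g v)) = leaf_weight n d (weight_step d w) \<phi>"
proof -
  have "{j - 1..j + 1} = {j - 1, j, j + 1}" for j :: int by auto
  then have "(\<Sum>g\<in>leaf_values n d \<phi>. \<Prod>v\<in>tree_leaves (Suc n) d. w (g v))
      = (\<Prod>v\<in>tree_leaves (Suc n) d. w (\<phi> (butlast v) - 1) + w (\<phi> (butlast v)) + w (\<phi> (butlast v) + 1))"
    unfolding leaf_values_def by (subst prod_sum_PiE[symmetric]) (auto simp: finite_tree_leaves add.assoc)
  also have "\<dots> = leaf_weight n d (weight_step d w) \<phi>"
    unfolding leaf_weight_def weight_step_def by (rule prod_tree_leaves_Suc)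
  finally show ?thesis .
qed

text \<open>Fubini for the decomposition into the restriction to depth n and the values on the last
  level: the inner sums are finite and all terms are nonnegative. The set S is left general to cover
  both the total mass and a prescribed restriction.\<close>

lemma leaf_weight_has_sum_Suc:
  assumes w: "\<And>i. 0 \<le> w i" and S: "S \<subseteq> lip_funs n d"
    and sum: "(leaf_weight n d (weight_step d w) has_sum A) S"
  shows "(leaf_weight (Suc n) d w has_sum A) {f \<in> lip_funs (Suc n) d. restr n f \<in> S}"
proof -
  let ?L = "tree_leaves (Suc n) d"
  let ?g = "\<lambda>(\<phi>, g). \<Prod>v\<in>?L. w (g v)"
  have inner: "((\<lambda>g. ?g (\<phi>, g)) has_sum leaf_weight n d (weight_step d w) \<phi>) (leaf_values n d \<phi>)" for \<phi>
    using leaf_values_sum[where n = n and d = d and \<phi> = \<phi> and w = w]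
    by (intro has_sum_finiteI) (auto simp: leaf_values_def intro!: finite_PiE finite_tree_leaves)
  have "(?g has_sum A) (Sigma S (leaf_values n d))"
  proof (rule has_sum_SigmaI[OF inner sum])
    show "?g summable_on Sigma S (leaf_values n d)"
      by (rule summable_on_SigmaI[OF inner])
        (use sum w in \<open>auto simp: summable_on_def intro!: prod_nonneg\<close>)
  qed
  also have "?this \<longleftrightarrow> (leaf_weight (Suc n) d w has_sum A) {f \<in> lip_funs (Suc n) d. restr n f \<in> S}"
  proof (rule has_sum_reindex_bij_witness[of _ "\<lambda>f. (restr n f, restrict f ?L)" "\<lambda>(\<phi>, g) v. if v \<in> ?L then g v else \<phi> v"],
      goal_cases)
    case (1 a)
    obtain \<phi> g where a: "a = (\<phi>, g)" by (cases a)
    have "\<phi> \<in> lip_funs n d" "g \<in> extensional ?L" using 1 S by (auto simp: a leaf_values_def PiE_def)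
    moreover have "restr n (\<lambda>v. if v \<in> ?L then g v else \<phi> v) = \<phi>"
      using \<open>\<phi> \<in> lip_funs n d\<close> by (auto simp: restr_def lip_funs_def tree_leaves_def tree_verts_def)
    ultimately show ?case by (auto simp: a extensional_def restrict_def)
  next
    case (2 a)
    obtain \<phi> g where a: "a = (\<phi>, g)" by (cases a)
    have \<phi>: "\<phi> \<in> S" "\<phi> \<in> lip_funs n d" and g: "g \<in> leaf_values n d \<phi>" using 2 S by (auto simp: a)
    let ?f = "\<lambda>v. if v \<in> ?L then g v else \<phi> v"
    have "restr n ?f = \<phi>"
      using \<phi>(2) by (auto simp: restr_def lip_funs_def tree_leaves_def tree_verts_def)
    moreover have "\<bar>?f v - ?f (v @ [i])\<bar> \<le> 1" if "v @ [i] \<in> tree_verts (Suc n) d" for v i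
    proof (cases "length v = n")
      case True
      then have "v @ [i] \<in> ?L" "v \<notin> ?L" using that by (auto simp: tree_leaves_def)
      moreover have "g (v @ [i]) \<in> {\<phi> v - 1..\<phi> v + 1}"
        using PiE_mem[OF g[unfolded leaf_values_def] \<open>v @ [i] \<in> ?L\<close>] by simp
      ultimately show ?thesis by auto
    next
      case False
      then have "v @ [i] \<notin> ?L" "v \<notin> ?L" "v @ [i] \<in> tree_verts n d"
        using that by (auto simp: tree_leaves_def tree_verts_def)
      then show ?thesis using \<phi>(2) by (simp add: lip_funs_def)
    qed
    moreover have "?f v = 0" if "v \<notin> tree_verts (Suc n) d" for v
      using that \<phi>(2) by (auto simp: lip_funs_def tree_leaves_def tree_verts_def)
    ultimately show ?case using \<phi>(1) by (auto simp: a lip_funs_def)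
  next
    case (3 f)
    then show ?case by (auto simp: restr_def lip_funs_def tree_leaves_def tree_verts_def fun_eq_iff)
  next
    case (4 f)
    have "restrict f ?L \<in> leaf_values n d (restr n f)"
      unfolding leaf_values_def
    proof (rule restrict_PiE_iff[THEN iffD2], intro ballI)
      fix v assume v: "v \<in> ?L"
      then have e: "butlast v @ [last v] = v"
        by (intro append_butlast_last_id) (auto simp: tree_leaves_def)
      have "\<bar>f (butlast v) - f (butlast v @ [last v])\<bar> \<le> 1"
      proof -
        have "butlast v @ [last v] \<in> tree_verts (Suc n) d" unfolding e using v by (simp add: tree_leaves_def)
        then show ?thesis using 4 unfolding lip_funs_def by blast
      qed
      moreover have "restr n f (butlast v) = f (butlast v)"
        using v by (simp add: restr_def tree_leaves_def)
      ultimately show "f v \<in> {restr n f (butlast v) - 1..restr n f (butlast v) + 1}"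
        by (auto simp: e)
    qed
    then show ?case using 4 by auto
  next
    case (5 a)
    then show ?case by (auto simp: leaf_weight_def intro!: prod.cong)
  qed simp
  finally show ?thesis .
qed

text \<open>Levels are peeled off from the leaves upwards, so the induction hypothesis is applied to
  the changed weight \<open>weight_step d w\<close>.\<close>

lemma leaf_weight_has_sum_add:
  assumes "\<And>i. 0 \<le> w i" "S \<subseteq> lip_funs r d"
    and "(leaf_weight r d ((weight_step d ^^ k) w) has_sum A) S"
  shows "(leaf_weight (r + k) d w has_sum A) {f \<in> lip_funs (r + k) d. restr r f \<in> S}"
  using assms
proof (induction k arbitrary: w)
  case 0
  have "restr r f = f" if "f \<in> lip_funs r d" for f
    using that by (auto simp: restr_def lip_funs_def tree_verts_def)
  then have "{f \<in> lip_funs r d. restr r f \<in> S} = S" using 0 by auto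
  then show ?case using 0 by simp
next
  case (Suc k)
  have "(leaf_weight (r + k) d (weight_step d w) has_sum A) {f \<in> lip_funs (r + k) d. restr r f \<in> S}"
    using Suc.prems by (intro Suc.IH) (auto intro: weight_step_nonneg simp: funpow_swap1)
  from leaf_weight_has_sum_Suc[OF Suc.prems(1) _ this]
  have "(leaf_weight (Suc (r + k)) d w has_sum A)
    {f \<in> lip_funs (Suc (r + k)) d. restr (r + k) f \<in> {f \<in> lip_funs (r + k) d. restr r f \<in> S}}"
    by auto
  also have "{f \<in> lip_funs (Suc (r + k)) d. restr (r + k) f \<in> {f \<in> lip_funs (r + k) d. restr r f \<in> S}}
      = {f \<in> lip_funs (Suc (r + k)) d. restr r f \<in> S}"
    using restr_lip_funs[of _ "Suc (r + k)" d "r + k"] by (auto simp: restr_restr)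
  finally show ?case by simp
qed

lemma leaf_weight_summable:
  assumes "0 < d" "\<And>i. 0 \<le> w i" "w summable_on UNIV"
  shows "leaf_weight n d w summable_on lip_funs n d"
  using assms(2,3)
proof (induction n arbitrary: w)
  case 0
  have L: "tree_leaves 0 d = {[]}" "tree_verts 0 d = {[]}" by (auto simp: tree_leaves_def tree_verts_def)
  have "w summable_on UNIV \<longleftrightarrow> leaf_weight 0 d w summable_on lip_funs 0 d"
    by (rule summable_on_reindex_bij_witness[of _ "\<lambda>f. f []" "\<lambda>i v. if v = [] then i else 0"])
      (auto simp: lip_funs_def leaf_weight_def L)
  with 0 show ?case by simp
next
  case (Suc n)
  have "leaf_weight n d (weight_step d w) summable_on lip_funs n d"
    using Suc.prems assms(1) by (intro Suc.IH weight_step_summable weight_step_nonneg)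
  then obtain A where "(leaf_weight n d (weight_step d w) has_sum A) (lip_funs n d)"
    by (auto simp: summable_on_def)
  from leaf_weight_has_sum_Suc[OF Suc.prems(1) order_refl this]
  have "(leaf_weight (Suc n) d w has_sum A) (lip_funs (Suc n) d)"
    using restr_lip_funs[of _ "Suc n" d n] by (simp add: Collect_conj_eq Collect_mem_eq cong: conj_cong)
  then show ?case by (auto simp: summable_on_def)
qed

text \<open>This is the measure on the tree of depth r with leaf weight x. Laws of restrictions and
  their limits all have this form.\<close>

definition tree_law :: "nat \<Rightarrow> nat \<Rightarrow> (int \<Rightarrow> real) \<Rightarrow> (nat list \<Rightarrow> int) \<Rightarrow> real" where
  "tree_law r d x \<phi> = (if \<phi> \<in> lip_funs r d then leaf_weight r d x \<phi> else 0)
     / infsum (leaf_weight r d x) (lip_funs r d)"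

lemma lawW_eq_tree_law:
  assumes "0 < d" "\<And>i. 0 \<le> w i" "w summable_on UNIV"
  shows "lawW (r + k) d w r \<phi> = tree_law r d ((weight_step d ^^ k) w) \<phi>"
proof -
  let ?W = "(weight_step d ^^ k) w"
  have W: "(\<forall>i. 0 \<le> ?W i) \<and> ?W summable_on UNIV"
    by (induction k) (use assms in \<open>auto intro: weight_step_nonneg weight_step_summable\<close>)
  have "(leaf_weight r d ?W has_sum infsum (leaf_weight r d ?W) (lip_funs r d)) (lip_funs r d)"
    using leaf_weight_summable[OF assms(1)] W by (intro has_sum_infsum) auto
  from leaf_weight_has_sum_add[OF assms(2) order_refl this]
  have "(leaf_weight (r + k) d w has_sum infsum (leaf_weight r d ?W) (lip_funs r d))
      {f \<in> lip_funs (r + k) d. restr r f \<in> lip_funs r d}" .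
  also have "{f \<in> lip_funs (r + k) d. restr r f \<in> lip_funs r d} = lip_funs (r + k) d"
    by (auto intro: restr_lip_funs)
  finally have den: "infsum (leaf_weight (r + k) d w) (lip_funs (r + k) d)
      = infsum (leaf_weight r d ?W) (lip_funs r d)" by (rule infsumI)
  have num: "infsum (leaf_weight (r + k) d w) {f \<in> lip_funs (r + k) d. restr r f = \<phi>}
      = (if \<phi> \<in> lip_funs r d then leaf_weight r d ?W \<phi> else 0)"
  proof (cases "\<phi> \<in> lip_funs r d")
    case True
    have "(leaf_weight r d ?W has_sum leaf_weight r d ?W \<phi>) {\<phi>}"
      by (intro has_sum_finiteI) auto
    from leaf_weight_has_sum_add[OF assms(2) _ this] True show ?thesis by (auto dest: infsumI)
  next
    case False
    then have "{f \<in> lip_funs (r + k) d. restr r f = \<phi>} = {}"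
      using restr_lip_funs[of _ "r + k" d r] by auto
    with False show ?thesis by (simp only: infsum_empty if_False)
  qed
  show ?thesis unfolding lawW_def den num tree_law_def ..
qed

text \<open>Every function acquires the same power of a, which cancels. Weights can thus be
  normalised to 1 at 0, and it is these normalised weights that converge.\<close>

lemma tree_law_scale:
  assumes "a \<noteq> 0"
  shows "tree_law r d (\<lambda>i. w i / a) \<phi> = tree_law r d w \<phi>"
proof -
  have "leaf_weight r d (\<lambda>i. w i / a) = (\<lambda>f. leaf_weight r d w f * inverse (a ^ card (tree_leaves r d)))"
    by (simp add: leaf_weight_def prod_dividef fun_eq_iff field_simps)
  then show ?thesis using assms by (simp add: tree_law_def infsum_cmult_left')
qed

text \<open>Lebesgue's theorem for the counting measure, transferred from
  \<open>infsetsum\<close>.\<close>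

lemma infsum_dominated_convergence:
  fixes f :: "'a \<Rightarrow> real"
  assumes "\<And>x. x \<in> A \<Longrightarrow> (\<lambda>n. F n x) \<longlonglongrightarrow> f x" "g summable_on A"
    and "\<And>n x. x \<in> A \<Longrightarrow> \<bar>F n x\<bar> \<le> g x"
  shows "(\<lambda>n. infsum (F n) A) \<longlonglongrightarrow> infsum f A"
proof -
  have g0: "0 \<le> g x" if "x \<in> A" for x using assms(3)[OF that, of 0] by linarith
  have g: "Infinite_Set_Sum.abs_summable_on g A"
    using assms(2) g0 by (simp flip: abs_summable_equivalent cong: summable_on_cong)
  have f_le: "\<bar>f x\<bar> \<le> g x" if "x \<in> A" for x
    using assms(1,3)[OF that] by (intro LIMSEQ_le_const2[OF tendsto_rabs]) auto
  have F: "Infinite_Set_Sum.abs_summable_on (F n) A" for n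
    by (rule Infinite_Set_Sum.abs_summable_on_comparison_test'[OF g]) (use assms(3) in auto)
  have f: "Infinite_Set_Sum.abs_summable_on f A"
    by (rule Infinite_Set_Sum.abs_summable_on_comparison_test'[OF g]) (use f_le in auto)
  have "(\<lambda>n. infsetsum (F n) A) \<longlonglongrightarrow> infsetsum f A"
    unfolding infsetsum_def
    by (rule integral_dominated_convergence[where w = g])
      (use assms g in \<open>auto simp: Infinite_Set_Sum.abs_summable_on_def AE_count_space\<close>)
  then show ?thesis
    using F f by (simp add: infsetsum_infsum)
qed

section \<open>From convergence of weights to convergence of laws\<close>

lemma leaf_weight_mono:
  "(\<And>i. 0 \<le> w i) \<Longrightarrow> (\<And>i. w i \<le> y i) \<Longrightarrow> leaf_weight r d w f \<le> leaf_weight r d y f"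
  unfolding leaf_weight_def by (intro prod_mono) auto

lemma leaf_weight_nonneg: "(\<And>i. 0 \<le> w i) \<Longrightarrow> 0 \<le> leaf_weight r d w f"
  unfolding leaf_weight_def by (intro prod_nonneg) auto

lemma leaf_weight_infsum_pos:
  assumes "0 < d" "\<And>i. 0 \<le> w i" "w summable_on UNIV" "0 < w 0"
  shows "0 < infsum (leaf_weight r d w) (lip_funs r d)"
proof -
  have "0 < leaf_weight r d w (\<lambda>v. 0)" using assms(4) by (simp add: leaf_weight_def prod_pos)
  also have "\<dots> \<le> infsum (leaf_weight r d w) (lip_funs r d)"
    using finite_sum_le_infsum[OF leaf_weight_summable[OF assms(1-3)], of "{\<lambda>v. 0}"]
      leaf_weight_nonneg[OF assms(2)] by (simp add: lip_funs_def)
  finally show ?thesis .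
qed

text \<open>The summable majorant for numerator and normalising sum is the leaf weight of Y.\<close>

lemma tendsto_tree_law:
  assumes "0 < d" "\<And>i. (\<lambda>n. X n i) \<longlonglongrightarrow> x i" "\<And>n i. 0 \<le> X n i" "\<And>n i. X n i \<le> Y i"
    and "Y summable_on UNIV" "0 < x 0"
  shows "(\<lambda>n. tree_law r d (X n) \<phi>) \<longlonglongrightarrow> tree_law r d x \<phi>"
proof -
  have Y: "0 \<le> Y i" for i using assms(3,4) order_trans by blast
  have lim: "(\<lambda>n. leaf_weight r d (X n) f) \<longlonglongrightarrow> leaf_weight r d x f" for f
    unfolding leaf_weight_def by (intro tendsto_prod assms)
  have x: "0 \<le> x i" "x i \<le> Y i" for i
    using assms(3,4) by (auto intro: LIMSEQ_le_const[OF assms(2)] LIMSEQ_le_const2[OF assms(2)])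
  have xs: "x summable_on UNIV" by (rule summable_on_comparison_test[OF assms(5)]) (use x in auto)
  have "(\<lambda>n. infsum (leaf_weight r d (X n)) (lip_funs r d)) \<longlonglongrightarrow> infsum (leaf_weight r d x) (lip_funs r d)"
    by (rule infsum_dominated_convergence[OF lim leaf_weight_summable[OF assms(1) Y assms(5)]])
      (use assms(3,4) in \<open>auto simp: leaf_weight_nonneg abs_of_nonneg intro: leaf_weight_mono\<close>)
  then show ?thesis
    unfolding tree_law_def using lim leaf_weight_infsum_pos[OF assms(1) x(1) xs assms(6), of r]
    by (intro tendsto_divide) auto
qed

lemma tree_law_pmf:
  assumes "0 < d" "\<And>i. 0 \<le> x i" "x summable_on UNIV" "0 < x 0"
  obtains Q where "\<And>\<phi>. pmf Q \<phi> = tree_law r d x \<phi>"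
proof -
  let ?Z = "infsum (leaf_weight r d x) (lip_funs r d)"
  have Z: "0 < ?Z" by (rule leaf_weight_infsum_pos[OF assms])
  have nn: "0 \<le> tree_law r d x \<phi>" for \<phi>
    using Z leaf_weight_nonneg[OF assms(2)] by (simp add: tree_law_def)
  have "(leaf_weight r d x has_sum ?Z) (lip_funs r d)"
    by (intro has_sum_infsum leaf_weight_summable assms)
  then have "((\<lambda>\<phi>. leaf_weight r d x \<phi> * inverse ?Z) has_sum (?Z * inverse ?Z)) (lip_funs r d)"
    by (rule has_sum_cmult_left)
  also have "?this \<longleftrightarrow> (tree_law r d x has_sum (?Z * inverse ?Z)) UNIV"
    by (rule has_sum_cong_neutral) (auto simp: tree_law_def field_simps)
  finally have hs: "(tree_law r d x has_sum 1) UNIV" using Z by simp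
  then have s: "Infinite_Set_Sum.abs_summable_on (tree_law r d x) UNIV"
    using nn by (auto simp: summable_on_def simp flip: abs_summable_equivalent)
  have "(\<integral>\<^sup>+ \<phi>. ennreal (tree_law r d x \<phi>) \<partial>count_space UNIV) = 1"
    using nn_integral_conv_infsetsum[OF s] nn infsetsum_infsum[OF s] infsumI[OF hs] by simp
  then show thesis
    using pmf_embed_pmf[of "tree_law r d x"] nn by (intro that[of "embed_pmf (tree_law r d x)"]) auto
qed

lemma lawU_eq_lawW:
  fixes k :: nat
  assumes "0 < d"
  defines "w \<equiv> \<lambda>i::int. if \<bar>i\<bar> \<le> int k then 1 else (0::real)"
  shows "lawU n d k r \<phi> = lawW n d w r \<phi>"
proof -
  have lw: "leaf_weight n d w f = (if \<forall>v\<in>tree_leaves n d. - int k \<le> f v \<and> f v \<le> int k then 1 else 0)" for f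
  proof (cases "\<forall>v\<in>tree_leaves n d. - int k \<le> f v \<and> f v \<le> int k")
    case True
    then have "w (f v) = 1" if "v \<in> tree_leaves n d" for v using that by (auto simp: w_def)
    then show ?thesis using True by (simp add: leaf_weight_def)
  next
    case False
    then obtain v where "v \<in> tree_leaves n d" "w (f v) = 0" by (auto simp: w_def)
    then show ?thesis using False finite_tree_leaves by (auto simp: leaf_weight_def)
  qed
  have "w summable_on UNIV \<longleftrightarrow> w summable_on {- int k..int k}"
    by (rule summable_on_cong_neutral) (auto simp: w_def)
  then have ws: "w summable_on UNIV" by simp
  have one: "infsum (leaf_weight n d w) {f \<in> lip_funs n d. P f} = infsum (\<lambda>f. 1) {f \<in> lip_funs_bdd n d k. P f}" for P
    by (rule infsum_cong_neutral) (auto simp: lip_funs_bdd_def lw)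
  have "leaf_weight n d w summable_on lip_funs n d"
    by (rule leaf_weight_summable[OF assms(1) _ ws]) (simp add: w_def)
  also have "?this \<longleftrightarrow> (\<lambda>f. 1 :: real) summable_on lip_funs_bdd n d k"
    by (rule summable_on_cong_neutral) (auto simp: lip_funs_bdd_def lw)
  \<comment> \<open>A nonzero constant is summable only over a finite set.\<close>
  finally have fin: "finite (lip_funs_bdd n d k)"
    using infsum_diverge_constant[of "lip_funs_bdd n d k" "1::real"] by auto
  then show ?thesis
    unfolding lawU_def lawW_def using one[of "\<lambda>f. restr r f = \<phi>"] one[of "\<lambda>f. True"] by simp
qed

section \<open>Convergence\<close>

text \<open>These properties of a good weight are preserved by \<open>weight_step\<close>; the decay
  at infinity is tracked through the ratios.\<close>

definition monotone_weight :: "(int \<Rightarrow> real) \<Rightarrow> bool" where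
  "monotone_weight w \<longleftrightarrow> (\<forall>i. 0 \<le> w i) \<and> (\<forall>i. w i = w (-i)) \<and> 0 < w 0
     \<and> (\<forall>i::nat. w (int i + 1) \<le> w (int i))"

definition weight_ratio :: "(int \<Rightarrow> real) \<Rightarrow> nat \<Rightarrow> real" where
  "weight_ratio w i = w (int i + 1) / w (int i)"

lemma monotone_weightD:
  assumes "monotone_weight w"
  shows "0 \<le> w i" "w (- i) = w i" "0 < w 0" "w (int j + 1) \<le> w (int j)"
  using assms by (auto simp: monotone_weight_def)

text \<open>It holds also where \<open>w (int i)\<close> vanishes, since monotonicity then forces
  the next weight to vanish.\<close>

lemma weight_ratio_mult:
  assumes "monotone_weight w"
  shows "weight_ratio w i * w (int i) = w (int i + 1)"
  using monotone_weightD(1)[OF assms, of "int i + 1"] monotone_weightD(4)[OF assms, of i]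
  by (auto simp: weight_ratio_def)

lemma weight_ratio_bounds:
  assumes "monotone_weight w"
  shows "0 \<le> weight_ratio w i" "weight_ratio w i \<le> 1"
  using monotone_weightD(1)[OF assms, of "int i"] monotone_weightD(1)[OF assms, of "int i + 1"]
    monotone_weightD(4)[OF assms, of i]
  by (simp_all add: weight_ratio_def divide_le_eq)

lemma monotone_weight_step:
  assumes "monotone_weight w"
  shows "monotone_weight (weight_step d w)"
proof -
  note w = monotone_weightD[OF assms]
  have "weight_step d w i = weight_step d w (- i)" for i
  proof -
    have "w (- i - 1) = w (i + 1)" "w (- i + 1) = w (i - 1)"
    proof -
      have "- i - 1 = - (i + 1)" "- i + 1 = - (i - 1)" by simp_all
      then show "w (- i - 1) = w (i + 1)" "w (- i + 1) = w (i - 1)" by (simp_all only: w(2))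
    qed
    then have "w (i - 1) + w i + w (i + 1) = w (- i - 1) + w (- i) + w (- i + 1)"
      using w(2)[of i] by linarith
    then show ?thesis by (simp only: weight_step_def)
  qed
  moreover have "0 < weight_step d w 0"
    unfolding weight_step_def using w(1)[of "-1"] w(1)[of 1] w(3) by (intro zero_less_power) auto
  moreover have "weight_step d w (int i + 1) \<le> weight_step d w (int i)" for i
  proof -
    \<comment> \<open>The two neighbour sums share two terms, so only this comparison remains; at i
      = 0 it uses w(-1) = w(1).\<close>
    have "w (int i + 2) \<le> w (int i - 1)"
    proof (cases i)
      case 0
      then show ?thesis using w(2)[of 1] w(4)[of 1] by simp
    next
      case (Suc j)
      then show ?thesis using w(4)[of j] w(4)[of "Suc j"] w(4)[of "Suc (Suc j)"] by (simp add: add_ac)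
    qed
    then show ?thesis
      unfolding weight_step_def using w(1) by (intro power_mono add_nonneg_nonneg) (auto simp: add_ac)
  qed
  ultimately show ?thesis using weight_step_nonneg[OF w(1)] by (simp add: monotone_weight_def)
qed

lemma monotone_weight_funpow:
  "monotone_weight w \<Longrightarrow> monotone_weight ((weight_step d ^^ n) w)"
  by (induction n) (auto intro: monotone_weight_step)

text \<open>Both neighbour sums are written as multiples of \<open>w 0\<close> at the root, where
  w(-1) = w(1), and of the weight to the left of i elsewhere.\<close>

lemma weight_ratio_step:
  assumes "monotone_weight w"
  shows "weight_ratio (weight_step d w) = ratio_step d (weight_ratio w) (weight_ratio w)"
proof
  fix i
  note w = monotone_weightD[OF assms]
  have r: "weight_ratio w j * w (int j) = w (int j + 1)"
    "weight_ratio w j * (weight_ratio w (Suc j) * w (int j)) = w (int j + 2)" for j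
    using weight_ratio_mult[OF assms, of j] weight_ratio_mult[OF assms, of "Suc j"]
    by (simp_all add: mult.assoc mult.commute[of "weight_ratio w j"] mult.left_commute[of "weight_ratio w j"] add_ac)
  show "weight_ratio (weight_step d w) i = ratio_step d (weight_ratio w) (weight_ratio w) i"
  proof (cases i)
    case 0
    have "(1 + weight_ratio w 0 + weight_ratio w 0 * weight_ratio w 1) * w 0 = w 0 + w 1 + w 2"
      "(1 + 2 * weight_ratio w 0) * w 0 = w (- 1) + w 0 + w 1"
      using r[of 0] w(2)[of 1] by (simp_all add: algebra_simps)
    then have "(w 0 + w 1 + w 2) / (w (- 1) + w 0 + w 1)
        = (1 + weight_ratio w 0 + weight_ratio w 0 * weight_ratio w 1) / (1 + 2 * weight_ratio w 0)"
      using w(3) by (metis less_irrefl mult_divide_mult_cancel_right)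
    then show ?thesis by (simp add: 0 weight_ratio_def[of "weight_step d w"] weight_step_def flip: power_divide)
  next
    case (Suc j)
    define a b c where "a = weight_ratio w (Suc j)" and "b = weight_ratio w (Suc (Suc j))" and "c = weight_ratio w j"
    have "c * (a * (b * w (int j))) = a * (b * w (int j + 1))"
      using r(1)[of j] by (simp add: c_def mult.left_commute)
    also have "\<dots> = w (int j + 3)"
      using r(2)[of "Suc j"] by (simp add: a_def b_def add_ac)
    finally have "w (int j + 1) + w (int j + 2) + w (int j + 3) = c * (1 + a + a * b) * w (int j)"
      "w (int j) + w (int j + 1) + w (int j + 2) = (1 + c + c * a) * w (int j)"
      using r[of j] by (simp_all add: a_def b_def c_def algebra_simps)
    then have "(w (int j + 1) + w (int j + 2) + w (int j + 3)) / (w (int j) + w (int j + 1) + w (int j + 2))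
        = c * (1 + a + a * b) / (1 + c + c * a)"
      \<comment> \<open>If \<open>w (int j)\<close> is 0, then c = 0 by the convention for division,
        and both sides are 0.\<close>
      by (cases "w (int j) = 0") (auto simp: c_def weight_ratio_def)
    then show ?thesis
      by (simp add: Suc weight_ratio_def[of "weight_step d w"] weight_step_def a_def b_def c_def add_ac
          flip: power_divide)
  qed
qed

lemma orbit_weight_ratio:
  assumes "monotone_weight w"
  shows "orbit d (\<lambda>n. weight_ratio ((weight_step d ^^ n) w))"
  unfolding orbit_def
  using weight_ratio_step[OF monotone_weight_funpow[OF assms]] weight_ratio_bounds[OF assms] by simp

lemma weight_eq_prod:
  assumes "monotone_weight w"
  shows "w i / w 0 = (\<Prod>j<nat \<bar>i\<bar>. weight_ratio w j)"
proof -
  have "w (int n) / w 0 = (\<Prod>j<n. weight_ratio w j)" for n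
  proof (induction n)
    case (Suc n)
    then show ?case using weight_ratio_mult[OF assms, of n]
      by (simp add: add_ac mult_ac flip: Suc.IH)
  qed (use monotone_weightD(3)[OF assms] in simp)
  from this[of "nat \<bar>i\<bar>"] show ?thesis
    using monotone_weightD(2)[OF assms, of i] by (cases "i \<ge> 0") auto
qed

text \<open>In the telescoping product the first k factors are at most 1 and the others at most c;
  truncated subtraction covers indices below k.\<close>

lemma weight_le_geometric:
  assumes "monotone_weight w" "0 \<le> c" "\<And>i. k \<le> i \<Longrightarrow> weight_ratio w i \<le> c"
  shows "w i / w 0 \<le> c ^ (nat \<bar>i\<bar> - k)"
proof -
  have "(\<Prod>j<n. weight_ratio w j) \<le> c ^ (n - k)" for n
  proof (induction n)
    case (Suc n)
    have p: "0 \<le> (\<Prod>j<n. weight_ratio w j)" by (intro prod_nonneg weight_ratio_bounds assms)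
    show ?case
    proof (cases "k \<le> n")
      case True
      then show ?thesis using Suc p assms weight_ratio_bounds[OF assms(1)]
        by (simp add: Suc_diff_le mult.commute[of c] mult_mono)
    next
      case False
      then show ?thesis using Suc p weight_ratio_bounds[OF assms(1)] by (simp add: mult_le_one)
    qed
  qed simp
  then show ?thesis using weight_eq_prod[OF assms(1)] by simp
qed

lemma summable_geometric_int:
  fixes c :: real
  assumes "0 \<le> c" "c < 1"
  shows "(\<lambda>i::int. c ^ (nat \<bar>i\<bar> - k)) summable_on UNIV"
proof -
  have "summable (\<lambda>n. c ^ (n - k))"
    using assms by (subst summable_iff_shift[symmetric, of _ k]) (simp add: summable_geometric)
  then have nat: "(\<lambda>n. c ^ (n - k)) summable_on UNIV"
    using assms by (subst summable_on_UNIV_nonneg_real_iff) auto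
  have "(\<lambda>i::int. c ^ (nat \<bar>i\<bar> - k)) summable_on range int"
    using nat by (subst summable_on_reindex) (auto simp: o_def)
  moreover have "(\<lambda>i::int. c ^ (nat \<bar>i\<bar> - k)) summable_on range (\<lambda>n. - int n)"
    using nat by (subst summable_on_reindex) (auto simp: o_def inj_on_def)
  ultimately have "(\<lambda>i::int. c ^ (nat \<bar>i\<bar> - k)) summable_on (range int \<union> range (\<lambda>n. - int n))"
    by (rule summable_on_union)
  also have "range int \<union> range (\<lambda>n. - int n) = UNIV"
  proof -
    have "i \<in> range int \<union> range (\<lambda>n. - int n)" for i
      by (cases i rule: int_cases2) auto
    then show ?thesis by blast
  qed
  finally show ?thesis .
qed

section \<open>Good weights and the limit law\<close>

lemma good_weight_monotone:
  assumes "good_weight w"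
  shows "monotone_weight w" "\<exists>k c. 0 \<le> c \<and> c < 1 \<and> (\<forall>i\<ge>k. weight_ratio w i \<le> c)"
proof -
  obtain k :: nat and c :: real where kc: "0 \<le> c" "c < 1"
    "\<And>i. i < k \<Longrightarrow> w (int i) = w (int i + 1)" "\<And>i. k \<le> i \<Longrightarrow> w (int i + 1) \<le> c * w (int i)"
    using assms unfolding good_weight_def by blast
  have nn: "0 \<le> w i" for i using assms by (simp add: good_weight_def)
  have "w (int i + 1) \<le> w (int i)" for i
  proof (cases "i < k")
    case False
    then have "w (int i + 1) \<le> c * w (int i)" using kc by simp
    also have "\<dots> \<le> 1 * w (int i)" using kc nn by (intro mult_right_mono) auto
    finally show ?thesis by simp
  qed (use kc in simp)
  then show "monotone_weight w" using assms unfolding good_weight_def monotone_weight_def by blast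
  have "weight_ratio w i \<le> c" if "k \<le> i" for i
    using kc(1) kc(4)[OF that] nn[of "int i"] by (auto simp: weight_ratio_def divide_le_eq)
  then show "\<exists>k c. 0 \<le> c \<and> c < 1 \<and> (\<forall>i\<ge>k. weight_ratio w i \<le> c)" using kc(1,2) by blast
qed

text \<open>The limit x is built from the limiting ratios alone, hence is the same for all w. Its
  positivity and summability stand under the implication because they are derived from the orbit of
  a good weight.\<close>

theorem good_weight_lawW_limit:
  assumes d: "2 \<le> d" "d \<le> 7"
  shows "\<exists>x. \<forall>w. good_weight w \<longrightarrow> (\<forall>i. 0 \<le> x i) \<and> x summable_on UNIV \<and> 0 < x 0 \<and>
    (\<forall>r \<phi>. (\<lambda>n. lawW n d w r \<phi>) \<longlonglongrightarrow> tree_law r d x \<phi>)"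
proof -
  obtain l where l: "\<forall>a. orbit d a \<and> (\<exists>k. \<exists>c<1. \<forall>i>k. a 0 i \<le> c) \<longrightarrow> (\<forall>i. (\<lambda>n. a n i) \<longlonglongrightarrow> l i)"
    using orbit_convergence[OF d] by blast
  define x :: "int \<Rightarrow> real" where "x = (\<lambda>i. \<Prod>j<nat \<bar>i\<bar>. l j)"
  have "(\<forall>i. 0 \<le> x i) \<and> x summable_on UNIV \<and> 0 < x 0 \<and>
    (\<forall>r \<phi>. (\<lambda>n. lawW n d w r \<phi>) \<longlonglongrightarrow> tree_law r d x \<phi>)" if good: "good_weight w" for w
  proof -
    note w = good_weight_monotone(1)[OF good]
    obtain k c where c: "0 \<le> c" "c < 1" "\<And>i. k \<le> i \<Longrightarrow> weight_ratio w i \<le> c"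
      using good_weight_monotone(2)[OF good] by blast
    define W where "W = (\<lambda>n. (weight_step d ^^ n) w)"
    define X where "X = (\<lambda>n i. W n i / W n 0)"
    have W: "monotone_weight (W n)" for n unfolding W_def by (rule monotone_weight_funpow[OF w])
    have orb: "orbit d (\<lambda>n. weight_ratio (W n))" unfolding W_def by (rule orbit_weight_ratio[OF w])
    have ini: "weight_ratio (W 0) i \<le> c" if "k < i" for i using c(3) that by (simp add: W_def)
    have "(\<lambda>n. weight_ratio (W n) i) \<longlonglongrightarrow> l i" for i
      using l orb c(2) ini by blast
    then have Xlim: "(\<lambda>n. X n i) \<longlonglongrightarrow> x i" for i
      unfolding X_def x_def weight_eq_prod[OF W] by (intro tendsto_prod)
    obtain e N where e: "0 \<le> e" "e < 1" "\<And>n i. N \<le> n \<Longrightarrow> weight_ratio (W n) (Suc i) \<le> e"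
      using orbit_eventually_contracting[OF orb d(1) c(2) ini] by blast
    \<comment> \<open>The exponent starts at index 1 because the root ratio is not bounded by
      e.\<close>
    define Y where "Y = (\<lambda>i::int. e ^ (nat \<bar>i\<bar> - 1))"
    have Y: "Y summable_on UNIV" unfolding Y_def by (rule summable_geometric_int[OF e(1,2)])
    have XY: "X (n + N) i \<le> Y i" for n i
      unfolding X_def Y_def
    proof (rule weight_le_geometric[OF W e(1)])
      fix j :: nat assume "1 \<le> j"
      then show "weight_ratio (W (n + N)) j \<le> e" using e(3)[of "n + N" "j - 1"] by simp
    qed
    have X0: "0 \<le> X n i" for n i
      using monotone_weightD[OF W] by (simp add: X_def less_imp_le)
    have x0: "0 \<le> x i" for i by (rule LIMSEQ_le_const[OF Xlim]) (use X0 in auto)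
    have xY: "x i \<le> Y i" for i
      by (rule LIMSEQ_le_const2[OF LIMSEQ_ignore_initial_segment[OF Xlim, where k = N]]) (use XY in auto)
    have xs: "x summable_on UNIV" by (rule summable_on_comparison_test[OF Y xY x0])
    have "(\<lambda>n. lawW n d w r \<phi>) \<longlonglongrightarrow> tree_law r d x \<phi>" for r \<phi>
    \<comment> \<open>The top r levels carry the restriction, and N further levels are summed out
      before the majorant applies.\<close>
    proof (rule LIMSEQ_offset[where k = "N + r"])
      have "w i \<le> c ^ (nat \<bar>i\<bar> - k) * w 0" for i
        using weight_le_geometric[OF w c(1,3)] monotone_weightD(3)[OF w] by (simp add: divide_le_eq)
      then have "w summable_on UNIV"
        using monotone_weightD(1)[OF w]
        by (intro summable_on_comparison_test[OF summable_on_cmult_left[OF summable_geometric_int[OF c(1,2)]]])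
      then have "lawW (n + (N + r)) d w r \<phi> = tree_law r d (X (n + N)) \<phi>" for n
        using lawW_eq_tree_law[of d w r "n + N" \<phi>] tree_law_scale[of "W (n + N) 0" r d "W (n + N)" \<phi>]
          monotone_weightD(1)[OF w] monotone_weightD(3)[OF W, of "n + N"] d
        by (simp add: X_def W_def add_ac)
      moreover have "(\<lambda>n. tree_law r d (X (n + N)) \<phi>) \<longlonglongrightarrow> tree_law r d x \<phi>"
        using d by (intro tendsto_tree_law[OF _ LIMSEQ_ignore_initial_segment[OF Xlim] X0 XY Y]) (auto simp: x_def)
      ultimately show "(\<lambda>n. lawW (n + (N + r)) d w r \<phi>) \<longlonglongrightarrow> tree_law r d x \<phi>" by simp
    qed
    then show ?thesis using x0 xs by (simp add: x_def)
  qed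
  then show ?thesis by (intro exI[of _ x] allI impI)
qed

lemma good_weight_indicator: "good_weight (\<lambda>i. if \<bar>i\<bar> \<le> int k then 1 else 0)"
  unfolding good_weight_def by (auto intro!: exI[of _ k] exI[of _ "0::real"])

theorem theorem2p6:
  fixes d :: nat
  assumes "2 \<le> d" and "d \<le> 7"
  shows "\<exists>Q :: nat \<Rightarrow> (nat list \<Rightarrow> int) pmf.
           (\<forall>w. good_weight w \<longrightarrow>
              (\<forall>r \<phi>. (\<lambda>n. lawW n d w r \<phi>) \<longlonglongrightarrow> pmf (Q r) \<phi>)) \<and>
           (\<forall>k::nat. \<forall>r \<phi>. (\<lambda>n. lawU n d k r \<phi>) \<longlonglongrightarrow> pmf (Q r) \<phi>)"
proof -
  obtain x where x: "\<And>w. good_weight w \<Longrightarrow> (\<forall>i. 0 \<le> x i) \<and> x summable_on UNIV \<and> 0 < x 0 \<and>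
      (\<forall>r \<phi>. (\<lambda>n. lawW n d w r \<phi>) \<longlonglongrightarrow> tree_law r d x \<phi>)"
    using good_weight_lawW_limit[OF assms] by metis
  have d: "0 < d" using assms by simp
  \<comment> \<open>The weight concentrated at 0 is good, which supplies the properties of
    x.\<close>
  have "\<exists>q. \<forall>\<phi>. pmf q \<phi> = tree_law r d x \<phi>" for r
    using tree_law_pmf[OF d, of x r] x[OF good_weight_indicator[of 0]] by metis
  then obtain Q where Q: "\<And>r \<phi>. pmf (Q r) \<phi> = tree_law r d x \<phi>" by metis
  have "(\<lambda>n. lawU n d k r \<phi>) \<longlonglongrightarrow> pmf (Q r) \<phi>" for k r \<phi>
    unfolding lawU_eq_lawW[OF d] Q using x[OF good_weight_indicator[of k]] by blast
  then show ?thesis using x by (intro exI[of _ Q]) (auto simp: Q)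
qed

end
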